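(* Let $\alpha>0$, $n\in\mathbb{N}$, and let $f:[0,\alpha)\to\mathbb{R}$ be a continuous function that is $n$-convex on $[0,\alpha)$ with $f(0)\le 0$. Let $g(t)=\frac{f(t)}{t}$ for $t\in(0,\alpha)$. Then: (1) If $f$ is of class $C^{2n}$ on $(0,\alpha)$, then, denoting by $\int g$ an antiderivative of $g$ on $(0,\alpha)$, the matrix $K_n(\int g;t)$ is positive semidefinite for every $t\in(0,\alpha)$. (2) When $n=2$, $g$ belongs to the class $Q_2((0,\alpha))$.
   Context: Let $M_n$ be the algebra of $n\times n$ complex matrices and $I\subset\mathbb{R}$ an interval. A function $f:I\to\mathbb{R}$ is $n$-convex on $I$ if $f(\lambda A+(1-\lambda)B)\le \lambda f(A)+(1-\lambda)f(B)$ for all $\lambda\in[0,1]$ and all selfadjoint $A,B\in M_n$ whose eigenvalues all lie in $I$ (functional calculus). For a function $h$ that is $2n$ times differentiable at $t$, $K_n(h;t)=\left(\frac{h^{(i+j)}(t)}{(i+j)!}\right)_{1\le i,j\le n}$. For a $C^1$ function $h$ on $I$, $[s,t]_h=\frac{h(s)-h(t)}{s-t}$ for $s\neq t$ and $[s,s]_h=h'(s)$. A Hermitian $n\times n$ matrix $A$ is almost positive (conditionally positive definite) if $\sum_{i,j}A_{ij}x_j\overline{x_i}\ge 0$ for all $x\in\mathbb{C}^n$ with $\sum_{i=1}^n x_i=0$. For $n\ge 2$, $Q_n(I)$ is the class of all real $C^1$ functions $h$ on $I$ such that for all $\lambda_1,\dots,\lambda_n\in I$ the matrix $([\lambda_i,\lambda_j]_h)_{1\le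 i,j\le n}$ is almost positive. *)

theory Defs
  imports "HOL-Analysis.Derivative" "Jordan_Normal_Form.Schur_Decomposition"
begin

section \<open>Selfadjoint complex matrices and their functional calculus\<close>

definition selfadjoint :: "complex mat \<Rightarrow> bool" where
  "selfadjoint A \<longleftrightarrow> mat_adjoint A = A"

definition unitary :: "nat \<Rightarrow> complex mat \<Rightarrow> bool" where
  "unitary n U \<longleftrightarrow> U \<in> carrier_mat n n \<and> mat_adjoint U * U = 1\<^sub>m n \<and> U * mat_adjoint U = 1\<^sub>m n"

definition unitary_conj :: "nat \<Rightarrow> complex mat \<Rightarrow> (nat \<Rightarrow> real) \<Rightarrow> complex mat" where
  "unitary_conj n U d = U * mat_diag n (\<lambda>i. complex_of_real (d i)) * mat_adjoint U"

text \<open>The functional calculus of a selfadjoint matrix: if A = U diag(d) U* with U unitary, then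
  f(A) = U diag(f(d)) U*.  By lemma \<open>fun_calc_unitary_conj\<close> below, the result does not depend on
  the chosen diagonalisation.\<close>

definition fun_calc :: "(real \<Rightarrow> real) \<Rightarrow> complex mat \<Rightarrow> complex mat" where
  "fun_calc f A = (THE B. \<exists>U d. unitary (dim_row A) U \<and>
     A = unitary_conj (dim_row A) U d \<and> B = unitary_conj (dim_row A) U (f \<circ> d))"

lemma mat_adjoint_carrier: "A \<in> carrier_mat n m \<Longrightarrow> mat_adjoint A \<in> carrier_mat m n"
  by (auto simp: mat_adjoint_def)

lemma unitary_conj_cong:
  assumes U: "unitary n U" and V: "unitary n V"
    and eq: "unitary_conj n U d = unitary_conj n V e"
  shows "unitary_conj n U (f \<circ> d) = unitary_conj n V (f \<circ> e)"
proof -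
  define U' V' where "U' = mat_adjoint U" and "V' = mat_adjoint V"
  define D where "D = (\<lambda>d :: nat \<Rightarrow> real. mat_diag n (\<lambda>i. complex_of_real (d i)))"
  have c[simp]: "U \<in> carrier_mat n n" "V \<in> carrier_mat n n"
      "U' \<in> carrier_mat n n" "V' \<in> carrier_mat n n" "\<And>d. D d \<in> carrier_mat n n"
    using U V by (auto simp: unitary_def U'_def V'_def D_def intro: mat_adjoint_carrier)
  have inv: "U' * U = 1\<^sub>m n" "V' * V = 1\<^sub>m n" "U * U' = 1\<^sub>m n" "V * V' = 1\<^sub>m n"
    using U V by (auto simp: unitary_def U'_def V'_def)
  define W where "W = V' * U"
  have W[simp]: "W \<in> carrier_mat n n" by (simp add: W_def mult_carrier_mat[of _ n n])
  note a = assoc_mult_mat[of _ n n _ n _ n] right_mult_one_mat[of _ n n] left_mult_one_mat[of _ n n]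
  have uc: "unitary_conj n U d = U * D d * U'" "unitary_conj n V d = V * D d * V'" for d
    by (simp_all add: unitary_conj_def U'_def V'_def D_def)
  have m[simp]: "\<And>A B. A \<in> carrier_mat n n \<Longrightarrow> B \<in> carrier_mat n n \<Longrightarrow> A * B \<in> carrier_mat n n"
    by (rule mult_carrier_mat)
  have "W * D d = V' * (U * D d * U') * U"
    by (simp add: a W_def inv)
  also have "\<dots> = V' * (V * D e * V') * U" using eq by (simp add: uc)
  also have "\<dots> = (V' * V) * (D e * (V' * U))" by (simp add: a)
  also have "\<dots> = D e * W" by (simp add: inv W_def a)
  finally have WD: "W * D d = D e * W" .
  have "W * D (f \<circ> d) = D (f \<circ> e) * W"
  proof (rule eq_matI)
    fix i j assume ij: "i < dim_row (D (f \<circ> e) * W)" "j < dim_col (D (f \<circ> e) * W)"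
    have ij: "i < n" "j < n" using ij carrier_matD[OF W] carrier_matD[OF c(5)] by auto
    have l: "(W * D d) $$ (i,j) = W $$ (i,j) * d j" for d :: "nat \<Rightarrow> real"
      unfolding D_def using ij by (subst mat_diag_mult_right[OF W]) auto
    have r: "(D d * W) $$ (i,j) = d i * W $$ (i,j)" for d :: "nat \<Rightarrow> real"
      unfolding D_def using ij by (subst mat_diag_mult_left[OF W]) auto
    have "W $$ (i,j) * d j = e i * W $$ (i,j)" using WD l r by metis
    hence "W $$ (i,j) = 0 \<or> d j = e i" by auto
    thus "(W * D (f \<circ> d)) $$ (i,j) = (D (f \<circ> e) * W) $$ (i,j)" by (auto simp: l r)
  qed (use carrier_matD[OF W] carrier_matD[OF c(5)] in auto)
  hence "V * (W * D (f \<circ> d)) * U' = V * (D (f \<circ> e) * W) * U'" by simp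
  moreover have "V * (W * D (f \<circ> d)) * U' = (V * V') * (U * (D (f \<circ> d) * U'))"
    by (simp add: a W_def)
  moreover have "V * (D (f \<circ> e) * W) * U' = V * (D (f \<circ> e) * (V' * (U * U')))"
    by (simp add: a W_def)
  ultimately show ?thesis by (simp add: uc inv a)
qed

lemma fun_calc_unitary_conj:
  assumes "unitary n U"
  shows "fun_calc f (unitary_conj n U d) = unitary_conj n U (f \<circ> d)"
proof -
  have n: "dim_row (unitary_conj n U d) = n"
    using assms by (auto simp: unitary_conj_def unitary_def)
  show ?thesis unfolding fun_calc_def n
    using assms by (intro the_equality) (blast, metis unitary_conj_cong)
qed

definition pos_semidef :: "complex mat \<Rightarrow> bool" where
  "pos_semidef A \<longleftrightarrow> selfadjoint A \<and> (\<forall>x \<in> carrier_vec (dim_row A). 0 \<le> (A *\<^sub>v x) \<bullet>c x)"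

definition loewner_le :: "complex mat \<Rightarrow> complex mat \<Rightarrow> bool" where
  "loewner_le A B \<longleftrightarrow> pos_semidef (B - A)"

definition eigenvalues_in :: "complex mat \<Rightarrow> real set \<Rightarrow> bool" where
  "eigenvalues_in A I \<longleftrightarrow> (\<forall>c. eigenvalue A c \<longrightarrow> c \<in> complex_of_real ` I)"

definition n_convex_on :: "nat \<Rightarrow> real set \<Rightarrow> (real \<Rightarrow> real) \<Rightarrow> bool" where
  "n_convex_on n I f \<longleftrightarrow>
     (\<forall>A \<in> carrier_mat n n. \<forall>B \<in> carrier_mat n n. \<forall>l \<in> {0..1::real}.
        selfadjoint A \<and> selfadjoint B \<and> eigenvalues_in A I \<and> eigenvalues_in B I \<longrightarrow>
        loewner_le
          (fun_calc f (complex_of_real l \<cdot>\<^sub>m A + complex_of_real (1 - l) \<cdot>\<^sub>m B))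
          (complex_of_real l \<cdot>\<^sub>m fun_calc f A + complex_of_real (1 - l) \<cdot>\<^sub>m fun_calc f B))"

section \<open>Differentiability classes and the matrices \<open>K\<^sub>n\<close>\<close>

text \<open>Class \<open>C\<^sup>k\<close> on an open set \<open>S\<close>; iterates of \<^const>\<open>deriv\<close> at points of an open set only depend
  on the values of the function on that set.\<close>

definition Ck_on_open :: "nat \<Rightarrow> real set \<Rightarrow> (real \<Rightarrow> real) \<Rightarrow> bool" where
  "Ck_on_open k S f \<longleftrightarrow>
     (\<forall>j<k. \<forall>t\<in>S. (deriv ^^ j) f field_differentiable (at t)) \<and> continuous_on S ((deriv ^^ k) f)"

text \<open>Matrix indices start at 0, hence the shift by 2 in \<open>i + j\<close>.\<close>

definition K_mat :: "nat \<Rightarrow> (real \<Rightarrow> real) \<Rightarrow> real \<Rightarrow> complex mat" where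
  "K_mat n h t = mat n n (\<lambda>(i, j). complex_of_real ((deriv ^^ (i + j + 2)) h t / fact (i + j + 2)))"

section \<open>The class \<open>Q\<^sub>n(I)\<close>\<close>

text \<open>At an endpoint belonging to \<open>I\<close>, derivatives are one-sided.\<close>

definition C1_on_interval :: "real set \<Rightarrow> (real \<Rightarrow> real) \<Rightarrow> bool" where
  "C1_on_interval I h \<longleftrightarrow>
     (\<forall>t\<in>I. h differentiable (at t within I)) \<and>
     continuous_on I (\<lambda>t. vector_derivative h (at t within I))"

definition divided_diff :: "real set \<Rightarrow> (real \<Rightarrow> real) \<Rightarrow> real \<Rightarrow> real \<Rightarrow> real" where
  "divided_diff I h s t =
     (if s = t then vector_derivative h (at s within I) else (h s - h t) / (s - t))"

definition almost_positive :: "complex mat \<Rightarrow> bool" where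
  "almost_positive A \<longleftrightarrow> selfadjoint A \<and>
     (\<forall>x :: nat \<Rightarrow> complex. (\<Sum>i<dim_row A. x i) = 0 \<longrightarrow>
        0 \<le> (\<Sum>i<dim_row A. \<Sum>j<dim_row A. A $$ (i, j) * x j * cnj (x i)))"

definition Q_class :: "nat \<Rightarrow> real set \<Rightarrow> (real \<Rightarrow> real) set" where
  "Q_class n I = {h. C1_on_interval I h \<and>
     (\<forall>l :: nat \<Rightarrow> real. (\<forall>i<n. l i \<in> I) \<longrightarrow>
        almost_positive (mat n n (\<lambda>(i, j). complex_of_real (divided_diff I h (l i) (l j)))))}"

end

theory Submission
  imports Defs "HOL-Analysis.Henstock_Kurzweil_Integration" "HOL-Analysis.Lipschitz"
begin

text \<open>The proof has two halves, a local one about \<open>f\<close> and a passage from \<open>f\<close> to \<open>f t / t\<close>.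

  \<^bold>\<open>Local half.\<close>  For \<open>f\<close> of class \<open>C\<^sup>2\<^sup>n\<close>, \<open>n\<close>-convexity forces the Hankel form
  \<open>\<Sum>i j. c i * c j * f\<^bsup>(i+j+2)\<^esup>(t) / (i+j+2)!\<close> (\<open>0 \<le> i, j < n\<close>) to be nonnegative
  (\<open>hankel_form_nonneg\<close>).  Let \<open>J s\<close> be the adjacency matrix of the path on \<open>n\<close> vertices with an
  extra entry \<open>s\<close> in the first corner.  Convexity is applied to \<open>t + h J 1\<close> and \<open>t + h J (-1)\<close>,
  whose midpoint is \<open>t + h J 0\<close>, and to the vector \<open>w\<close> with entries \<open>h\<^bsup>n-1-i\<^esup> c i\<close>.  All three
  matrices have explicit orthonormal eigenbases made of sines, so the inequality becomes
  \<open>0 \<le> \<Sum>k. a k * f (t + p k)\<close> with weights and nodes that depend on \<open>n\<close>, \<open>h\<close> and \<open>c\<close> only.  The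
  moments of this functional are second differences of \<open>h\<^bsup>m\<^esup> \<langle>(J s)\<^bsup>m\<^esup> w, w\<rangle>\<close> in \<open>s\<close>; they telescope, and
  after division by \<open>h\<^bsup>2n\<^esup>\<close> they converge to \<open>2 \<Sum>i+j+2=m. c i * c j\<close>.  Taylor's formula of order
  \<open>2n\<close> at \<open>t\<close> then gives the claim, without any derivative of the functional calculus.

  \<^bold>\<open>Passage to the quotient.\<close>  The derivatives of \<open>(f t - C) / t\<close> at \<open>t\<close> are, up to
  elementary factors, the differences \<open>P m t 0 - C\<close>, where \<open>P m t e\<close> is the value at \<open>e\<close> of the
  Taylor polynomial of \<open>f\<close> of degree \<open>m\<close> at \<open>t\<close>.  For \<open>0 < e\<close> the corresponding form in \<open>P m t e\<close>
  has, as a function of \<open>t > e\<close>, a derivative which is a Hankel form of \<open>f\<close> at \<open>t\<close>, hence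
  nonnegative, and its value at \<open>t = e\<close> is \<open>- R * f e\<close> with \<open>R \<ge> 0\<close> by positivity of the Cauchy
  matrix \<open>1 / (i+j+2)\<close>.  Letting \<open>e\<close> tend to \<open>0\<close> and using \<open>f 0 \<le> C\<close> gives part (1), with \<open>C = 0\<close>
  (\<open>quotient_hankel_form_nonneg\<close>).

  \<^bold>\<open>Part (2).\<close>  Here \<open>f\<close> is merely continuous.  The inequalities
  \<open>0 \<le> \<Sum>k. a k * f (t + p k)\<close> survive averaging over translations of \<open>f\<close>; four such averages
  produce a function of class \<open>C\<^sup>4\<close>, to which the above applies, and the last diagonal entry of the
  form says that the third derivative of its quotient is nonnegative.  In the limit all third
  divided differences of \<open>g\<close> are nonnegative (\<open>dd_quotient_nonneg\<close>).  This makes the second divided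
  differences monotone and locally bounded, so that \<open>g\<close> is of class \<open>C\<^sup>1\<close>, and it yields the
  trapezoid inequality \<open>2 * (g b - g a) / (b - a) \<le> g' a + g' b\<close>, which is what membership in
  \<open>Q\<^sub>2\<close> means.\<close>

section \<open>Path matrices and their eigenvectors\<close>

text \<open>The standard inner product of the first \<open>n\<close> coordinates.\<close>

definition inner_upto :: "nat \<Rightarrow> (nat \<Rightarrow> real) \<Rightarrow> (nat \<Rightarrow> real) \<Rightarrow> real" where
  "inner_upto n x y = (\<Sum>i<n. x i * y i)"

text \<open>The path matrix \<open>J s\<close>: it adds the two neighbouring coordinates, and the missing left neighbour
  of coordinate \<open>0\<close> is replaced by \<open>s * x 0\<close>.  Vectors are functions on \<open>nat\<close>; only the coordinates below
  \<open>n\<close> matter.\<close>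

definition path_op :: "nat \<Rightarrow> real \<Rightarrow> (nat \<Rightarrow> real) \<Rightarrow> nat \<Rightarrow> real" where
  "path_op n s x i = (if i = 0 then s * x 0 else x (i - 1)) + (if Suc i < n then x (Suc i) else 0)"

text \<open>The first unit vector.\<close>

abbreviation e0 :: "nat \<Rightarrow> real" where
  "e0 \<equiv> (\<lambda>i. of_bool (i = 0))"

lemma inner_upto_commute: "inner_upto n x y = inner_upto n y x"
  by (simp add: inner_upto_def mult.commute)

lemma inner_upto_e0: "n > 0 \<Longrightarrow> inner_upto n x e0 = x 0"
  by (simp add: inner_upto_def of_bool_def if_distrib cong: if_cong)

lemma path_op_symmetric: "inner_upto n (path_op n s x) y = inner_upto n x (path_op n s y)"
proof (cases n)
  case 0
  then show ?thesis by (simp add: inner_upto_def)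
next
  case (Suc m)
  have shift: "(\<Sum>i<n. (if i = 0 then s * u 0 else u (i - 1)) * v i)
      = s * u 0 * v 0 + (\<Sum>i<m. u i * v (Suc i))" for u v :: "nat \<Rightarrow> real"
    unfolding Suc by (subst sum.lessThan_Suc_shift) simp
  have shift': "(\<Sum>i<n. (if Suc i < n then u (Suc i) else 0) * v i)
      = (\<Sum>i<m. u (Suc i) * v i)" for u v :: "nat \<Rightarrow> real"
    unfolding Suc by simp
  have *: "inner_upto n (path_op n s u) v
      = s * u 0 * v 0 + (\<Sum>i<m. u i * v (Suc i)) + (\<Sum>i<m. u (Suc i) * v i)"
    for u v :: "nat \<Rightarrow> real"
    unfolding inner_upto_def path_op_def distrib_right sum.distrib shift shift' by simp
  show ?thesis
    by (subst inner_upto_commute[of n x]) (simp add: * mult_ac)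
qed

lemma path_op_pow_symmetric:
  "inner_upto n ((path_op n s ^^ k) x) y = inner_upto n x ((path_op n s ^^ k) y)"
proof (induction k arbitrary: y)
  case (Suc k)
  have "inner_upto n ((path_op n s ^^ Suc k) x) y = inner_upto n x ((path_op n s ^^ k) (path_op n s y))"
    by (simp add: path_op_symmetric Suc.IH)
  then show ?case by (simp add: funpow_swap1)
qed simp

lemma path_op_pow_0: "n > 0 \<Longrightarrow> (path_op n s ^^ k) x 0 = inner_upto n x ((path_op n s ^^ k) e0)"
  by (metis inner_upto_e0 path_op_pow_symmetric)

text \<open>\<open>(J s)\<^bsup>k\<^esup> e0\<close> is supported on the coordinates up to \<open>k\<close>, with \<open>k\<close>-th coordinate \<open>1\<close>: a walk
  of length \<open>k\<close> from \<open>0\<close> to \<open>k\<close> is unique.\<close>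

lemma path_op_pow_e0:
  shows "(k < i \<longrightarrow> (path_op n s ^^ k) e0 i = 0) \<and> (k < n \<longrightarrow> (path_op n s ^^ k) e0 k = 1)"
proof (induction k arbitrary: i)
  case (Suc k)
  then show ?case by (auto simp: path_op_def)
qed auto

text \<open>Since \<open>J s - J s'\<close> is \<open>s - s'\<close> times the projection onto \<open>e0\<close>, differences of powers telescope
  into products of first coordinates.\<close>

lemma path_op_pow_diff:
  "n > 0 \<Longrightarrow> inner_upto n ((path_op n s ^^ k) x) y - inner_upto n ((path_op n s' ^^ k) x) y
    = (s - s') * (\<Sum>p<k. (path_op n s' ^^ (k - 1 - p)) x 0 * (path_op n s ^^ p) y 0)"
proof (induction k arbitrary: y)
  case (Suc k)
  let ?J = "path_op n s" and ?J' = "path_op n s'"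
  have diff: "inner_upto n z (?J y) - inner_upto n z (?J' y) = (s - s') * z 0 * y 0" for z
  proof -
    have "inner_upto n z (?J y) - inner_upto n z (?J' y)
        = (\<Sum>i<n. if i = 0 then z i * ((s - s') * y 0) else 0)"
      unfolding inner_upto_def sum_subtractf[symmetric] path_op_def
      by (intro sum.cong) (auto simp: algebra_simps)
    then show ?thesis using Suc.prems by (simp add: mult_ac)
  qed
  have "inner_upto n ((?J ^^ Suc k) x) y - inner_upto n ((?J' ^^ Suc k) x) y
      = (inner_upto n ((?J ^^ k) x) (?J y) - inner_upto n ((?J' ^^ k) x) (?J y))
        + (inner_upto n ((?J' ^^ k) x) (?J y) - inner_upto n ((?J' ^^ k) x) (?J' y))"
    by (simp add: path_op_symmetric)
  also have "\<dots> = (s - s') * ((\<Sum>p<k. (?J' ^^ (k - 1 - p)) x 0 * (?J ^^ p) (?J y) 0)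
        + (?J' ^^ k) x 0 * y 0)"
    unfolding diff Suc.IH[OF Suc.prems] by (simp add: algebra_simps)
  also have "\<dots> = (s - s') * (\<Sum>p<Suc k. (?J' ^^ (Suc k - 1 - p)) x 0 * (?J ^^ p) y 0)"
    by (subst sum.lessThan_Suc_shift) (simp add: funpow_swap1)
  finally show ?case .
qed simp

lemma path_op_second_diff:
  assumes n: "n > 0"
  shows "inner_upto n ((path_op n 1 ^^ k) w) w + inner_upto n ((path_op n (-1) ^^ k) w) w
      - 2 * inner_upto n ((path_op n 0 ^^ k) w) w
    = 2 * (\<Sum>p<k. \<Sum>q<p. (path_op n 0 ^^ (k - 1 - p)) w 0
        * (path_op n 1 ^^ q) e0 0 * (path_op n (-1) ^^ (p - 1 - q)) w 0)"
proof -
  let ?a = "\<lambda>s p. (path_op n s ^^ p) w 0"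
  have a: "?a 1 p - ?a (-1) p = 2 * (\<Sum>q<p. ?a (-1) (p - 1 - q) * (path_op n 1 ^^ q) e0 0)" for p
    using path_op_pow_diff[OF n, where s = 1 and s' = "-1" and k = p and x = w and y = e0]
        by (simp add: inner_upto_e0 n)
  have "inner_upto n ((path_op n 1 ^^ k) w) w + inner_upto n ((path_op n (-1) ^^ k) w) w
      - 2 * inner_upto n ((path_op n 0 ^^ k) w) w
    = (\<Sum>p<k. ?a 0 (k - 1 - p) * (?a 1 p - ?a (-1) p))"
    using path_op_pow_diff[OF n, where s = 1 and s' = 0 and k = k and x = w and y = w]
      path_op_pow_diff[OF n, where s = "-1" and s' = 0 and k = k and x = w and y = w]
    by (simp add: right_diff_distrib sum_subtractf)
  also have "\<dots> = 2 * (\<Sum>p<k. \<Sum>q<p. ?a 0 (k - 1 - p) * (path_op n 1 ^^ q) e0 0 * ?a (-1) (p - 1 - q))"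
    unfolding a sum_distrib_left by (intro sum.cong refl) (simp add: mult_ac)
  finally show ?thesis .
qed

text \<open>The vector \<open>sin ((n - j) \<theta>)\<close> vanishes at the missing right neighbour \<open>j = n\<close>; the equation at the
  left end is the hypothesis on \<open>\<theta>\<close>.\<close>

lemma path_op_sin_eigenvector:
  assumes i: "i < n" and bdry: "s * sin (n * \<theta>) = sin ((real n + 1) * \<theta>)"
  shows "path_op n s (\<lambda>j. sin ((real n - j) * \<theta>)) i = 2 * cos \<theta> * sin ((real n - i) * \<theta>)"
proof -
  have left: "(if i = 0 then s * sin ((real n - real 0) * \<theta>) else sin ((real n - real (i - 1)) * \<theta>))
      = sin ((real n - i) * \<theta> + \<theta>)"
    using bdry by (auto simp: algebra_simps of_nat_diff)
  have right: "(if Suc i < n then sin ((real n - real (Suc i)) * \<theta>) else 0)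
      = sin ((real n - i) * \<theta> - \<theta>)"
  proof (cases "Suc i < n")
    case False
    with i have "real n - real i = 1" by linarith
    then show ?thesis using False by simp
  qed (simp add: algebra_simps)
  show ?thesis unfolding path_op_def left right by (simp add: sin_add sin_diff)
qed

text \<open>For \<open>s = 0, 1, -1\<close> the boundary equation is solved in \<open>(0, \<pi>)\<close> by the \<open>n\<close> multiples
  \<open>k + 1\<close>, \<open>2k + 1\<close>, \<open>2k + 2\<close> of \<open>\<pi>/(n+1)\<close>, \<open>\<pi>/(2n+1)\<close>, \<open>\<pi>/(2n+1)\<close>.\<close>

lemma path_op_eigenvalues:
  assumes s: "s \<in> {-1, 0, 1}"
  obtains \<theta> :: "nat \<Rightarrow> real" where
    "\<And>k. k < n \<Longrightarrow> 0 < \<theta> k \<and> \<theta> k < pi \<and> s * sin (n * \<theta> k) = sin ((real n + 1) * \<theta> k)"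
    "inj_on \<theta> {..<n}"
proof -
  have frac: "(\<forall>k<n. 0 < p k / q * pi \<and> p k / q * pi < pi) \<and> inj_on (\<lambda>k. p k / q * pi) {..<n}"
    if pq: "\<And>k. k < n \<Longrightarrow> 0 < p k \<and> p k < q" and p: "inj p" for p :: "nat \<Rightarrow> real" and q
  proof -
    have "0 < p k / q * pi \<and> p k / q * pi < pi" if "k < n" for k
    proof -
      have "0 < p k / q \<and> p k / q < 1" using pq[OF that] by (simp add: divide_less_eq)
      then show ?thesis by (metis mult_1 mult_pos_pos mult_strict_right_mono pi_gt_zero)
    qed
    moreover have "k = l" if kl: "k < n" "p k / q * pi = p l / q * pi" for k l
    proof -
      have "q \<noteq> 0" using pq[OF kl(1)] by linarith
      then have "p k = p l" using kl(2) pi_gt_zero by simp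
      then show ?thesis using p by (simp add: inj_eq)
    qed
    ultimately show ?thesis unfolding inj_on_def by blast
  qed
  have split: "(real n + 1) * x + n * x = (2 * real n + 1) * x" for x :: real
      by (simp add: algebra_simps)
  consider "s = 0" | "s = 1" | "s = -1" using s by auto
  then show thesis
  proof cases
    case 1
    let ?t = "\<lambda>k. (real k + 1) / (real n + 1) * pi"
    have "sin ((real n + 1) * ?t k) = 0" for k
      using sin_npi[of "Suc k"] by (simp add: add.commute)
    then have "s * sin (n * ?t k) = sin ((real n + 1) * ?t k)" for k using 1 by simp
    moreover have "(\<forall>k<n. 0 < ?t k \<and> ?t k < pi) \<and> inj_on ?t {..<n}"
      by (rule frac) (auto simp: inj_def)
    ultimately show thesis by (intro that[of ?t]) blast+
  next
    case 2
    let ?t = "\<lambda>k. (2 * real k + 1) / (2 * real n + 1) * pi"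
    have "sin (n * ?t k) = sin ((real n + 1) * ?t k)" for k
    proof -
      have "(real n + 1) * ?t k + n * ?t k = (2 * real n + 1) * ?t k" by (rule split)
      also have "\<dots> = real (2 * k + 1) * pi" by simp
      finally have eq: "(real n + 1) * ?t k = real (2 * k + 1) * pi - n * ?t k"
          by (simp only: eq_diff_eq)
      show ?thesis unfolding eq sin_diff cos_npi sin_npi by simp
    qed
    then have "s * sin (n * ?t k) = sin ((real n + 1) * ?t k)" for k using 2 by simp
    moreover have "(\<forall>k<n. 0 < ?t k \<and> ?t k < pi) \<and> inj_on ?t {..<n}"
      by (rule frac) (auto simp: inj_def)
    ultimately show thesis by (intro that[of ?t]) blast+
  next
    case 3
    let ?t = "\<lambda>k. (2 * real k + 2) / (2 * real n + 1) * pi"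
    have "- sin (n * ?t k) = sin ((real n + 1) * ?t k)" for k
    proof -
      have "(real n + 1) * ?t k + n * ?t k = (2 * real n + 1) * ?t k" by (rule split)
      also have "\<dots> = real (2 * (k + 1)) * pi" by simp
      finally have eq: "(real n + 1) * ?t k = real (2 * (k + 1)) * pi - n * ?t k"
          by (simp only: eq_diff_eq)
      show ?thesis unfolding eq sin_diff cos_npi sin_npi by simp
    qed
    then have "s * sin (n * ?t k) = sin ((real n + 1) * ?t k)" for k using 3 by simp
    moreover have "(\<forall>k<n. 0 < ?t k \<and> ?t k < pi) \<and> inj_on ?t {..<n}"
      by (rule frac) (auto simp: inj_def)
    ultimately show thesis by (intro that[of ?t]) blast+
  qed
qed

lemma orthonormal_completeness:
  fixes u :: "nat \<Rightarrow> nat \<Rightarrow> real"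
  assumes on: "\<And>k l. k < n \<Longrightarrow> l < n \<Longrightarrow> inner_upto n (u k) (u l) = of_bool (k = l)"
    and i: "i < n" and j: "j < n"
  shows "(\<Sum>k<n. u k i * u k j) = of_bool (i = j)"
proof -
  define A where "A = mat n n (\<lambda>(k, i). u k i)"
  have A: "A \<in> carrier_mat n n" by (simp add: A_def)
  have "A * A\<^sup>T = 1\<^sub>m n"
    by (rule eq_matI)
      (use on in \<open>auto simp: A_def scalar_prod_def inner_upto_def atLeast0LessThan\<close>)
  then have "A\<^sup>T * A = 1\<^sub>m n"
    using A by (intro mat_mult_left_right_inverse[of A]) auto
  then have "(A\<^sup>T * A) $$ (i, j) = of_bool (i = j)" using i j by simp
  then show ?thesis using i j
    by (simp add: A_def scalar_prod_def atLeast0LessThan)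
qed

text \<open>The eigenvalues \<open>2 cos \<theta>\<close> are distinct, so symmetry makes the sine vectors orthogonal.\<close>

lemma path_op_orthonormal_eigenbasis:
  assumes s: "s \<in> {-1, 0, 1}"
  obtains u :: "nat \<Rightarrow> nat \<Rightarrow> real" and \<mu> :: "nat \<Rightarrow> real" where
    "\<And>k. k < n \<Longrightarrow> \<bar>\<mu> k\<bar> \<le> 2"
    "\<And>k i. k < n \<Longrightarrow> i < n \<Longrightarrow> path_op n s (u k) i = \<mu> k * u k i"
    "\<And>k l. k < n \<Longrightarrow> l < n \<Longrightarrow> inner_upto n (u k) (u l) = of_bool (k = l)"
proof -
  obtain \<theta> :: "nat \<Rightarrow> real" where \<theta>: "\<And>k. k < n \<Longrightarrow> 0 < \<theta> k \<and> \<theta> k < pi \<and> s * sin (n * \<theta> k)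
      = sin ((real n + 1) * \<theta> k)"
    and inj: "inj_on \<theta> {..<n}"
    by (rule path_op_eigenvalues[OF s, of n]) blast
  define v where "v = (\<lambda>k j. sin ((real n - real j) * \<theta> k))"
  have ev: "path_op n s (v k) i = 2 * cos (\<theta> k) * v k i" if "k < n" "i < n" for k i
    unfolding v_def using path_op_sin_eigenvector[OF that(2)] \<theta>[OF that(1)] by blast
  define N where "N = (\<lambda>k. sqrt (inner_upto n (v k) (v k)))"
  have pos: "inner_upto n (v k) (v k) > 0" if k: "k < n" for k
  proof -
    have "v k (n - 1) = sin (\<theta> k)" using k by (simp add: v_def of_nat_diff)
    moreover have "sin (\<theta> k) > 0" using \<theta>[OF k] by (intro sin_gt_zero) blast+
    ultimately have "v k (n - 1) * v k (n - 1) > 0" by (metis mult_pos_pos)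
    then show ?thesis unfolding inner_upto_def
      by (intro sum_pos2[of _ "n - 1"]) (use k in simp_all)
  qed
  \<comment> \<open>eigenvectors of a symmetric operator for different eigenvalues are orthogonal\<close>
  have orth: "inner_upto n (v k) (v l) = 0" if k: "k < n" and l: "l < n" and "k \<noteq> l" for k l
  proof -
    have "2 * cos (\<theta> k) * inner_upto n (v k) (v l) = inner_upto n (path_op n s (v k)) (v l)"
      unfolding inner_upto_def sum_distrib_left by (intro sum.cong) (auto simp: ev k)
    also have "\<dots> = inner_upto n (v k) (path_op n s (v l))" by (rule path_op_symmetric)
    also have "\<dots> = 2 * cos (\<theta> l) * inner_upto n (v k) (v l)"
      unfolding inner_upto_def sum_distrib_left by (intro sum.cong) (auto simp: ev l)
    finally have "cos (\<theta> k) = cos (\<theta> l) \<or> inner_upto n (v k) (v l) = 0" by auto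
    moreover have "\<theta> k \<noteq> \<theta> l" using inj k l \<open>k \<noteq> l\<close> by (auto simp: inj_on_def)
    ultimately show ?thesis
      using \<theta>[OF k] \<theta>[OF l] cos_inj_pi[of "\<theta> k" "\<theta> l"] less_imp_le by blast
  qed
  show thesis
  proof (rule that[of "\<lambda>k. 2 * cos (\<theta> k)" "\<lambda>k i. v k i / N k"])
    show "\<bar>2 * cos (\<theta> k)\<bar> \<le> 2" for k using abs_cos_le_one[of "\<theta> k"] by (simp add: abs_mult)
    show "path_op n s (\<lambda>i. v k i / N k) i = 2 * cos (\<theta> k) * (v k i / N k)" if "k < n" "i < n" for k i
    proof -
      have "path_op n s (\<lambda>i. v k i / N k) i = path_op n s (v k) i / N k"
        by (simp add: path_op_def add_divide_distrib)
      then show ?thesis by (simp add: ev that)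
    qed
    show "inner_upto n (\<lambda>i. v k i / N k) (\<lambda>i. v l i / N l) = of_bool (k = l)"
      if k: "k < n" and l: "l < n" for k l
    proof -
      have "inner_upto n (\<lambda>i. v k i / N k) (\<lambda>i. v l i / N l) = inner_upto n (v k) (v l) / (N k * N l)"
        by (simp add: inner_upto_def sum_divide_distrib)
      then show ?thesis using orth[OF k l] pos[OF k] by (auto simp: N_def)
    qed
  qed
qed

section \<open>Finite inequalities implied by matrix convexity\<close>

text \<open>A finite family of weights \<open>a\<close> and nodes \<open>p\<close> such that \<open>0 \<le> \<Sum>k\<in>K. a k * f (t + p k)\<close> for every
  \<open>n\<close>-convex function \<open>f\<close> and every translation \<open>t\<close> which keeps the nodes in the domain.  In the families
  below, an index \<open>(s, k)\<close> refers to the \<open>k\<close>-th eigenvalue of the matrix number \<open>s \<in> {-1, 0, 1}\<close>.\<close>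

definition convexity_test :: "nat \<Rightarrow> (int \<times> nat) set \<Rightarrow> (int \<times> nat \<Rightarrow> real) \<Rightarrow> (int \<times> nat \<Rightarrow> real) \<Rightarrow> bool" where
  "convexity_test n K a p \<longleftrightarrow> finite K \<and>
    (\<forall>f I. n_convex_on n I f \<longrightarrow>
      (\<forall>t. (\<forall>k\<in>K. t + p k \<in> I) \<longrightarrow> 0 \<le> (\<Sum>k\<in>K. a k * f (t + p k))))"

text \<open>The functions that satisfy all these inequalities.  Contrary to matrix convexity itself, this
  property involves only finite sums of values, so it is visibly stable under averages of translates.\<close>

definition passes_convexity_tests :: "nat \<Rightarrow> real set \<Rightarrow> (real \<Rightarrow> real) \<Rightarrow> bool" where
  "passes_convexity_tests n I f \<longleftrightarrow>
    (\<forall>K a p t. convexity_test n K a p \<longrightarrow> (\<forall>k\<in>K. t + p k \<in> I) \<longrightarrow> 0 \<le> (\<Sum>k\<in>K. a k * f (t + p k)))"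

lemma n_convex_on_passes_tests: "n_convex_on n I f \<Longrightarrow> passes_convexity_tests n I f"
  by (auto simp: passes_convexity_tests_def convexity_test_def)

lemma mat_adjoint_index:
  assumes "A \<in> carrier_mat n m" "i < m" "j < n"
  shows "mat_adjoint A $$ (i, j) = cnj (A $$ (j, i))"
  using assms unfolding mat_adjoint_def by (auto simp: mat_of_rows_index)

text \<open>The matrix with columns \<open>u 0, \<dots>, u (n - 1)\<close>.\<close>

definition basis_mat :: "nat \<Rightarrow> (nat \<Rightarrow> nat \<Rightarrow> real) \<Rightarrow> complex mat" where
  "basis_mat n u = mat n n (\<lambda>(i, k). complex_of_real (u k i))"

lemma basis_mat_adjoint: "mat_adjoint (basis_mat n u) = mat n n (\<lambda>(k, i). complex_of_real (u k i))"
proof -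
  have c: "basis_mat n u \<in> carrier_mat n n" by (simp add: basis_mat_def)
  show ?thesis
  proof (rule eq_matI)
    show "mat_adjoint (basis_mat n u) $$ (i, j) = mat n n (\<lambda>(k, i). complex_of_real (u k i)) $$ (i, j)"
      if "i < dim_row (mat n n (\<lambda>(k, i). complex_of_real (u k i)))"
        "j < dim_col (mat n n (\<lambda>(k, i). complex_of_real (u k i)))" for i j
      using that by (simp add: mat_adjoint_index[OF c]) (simp add: basis_mat_def)
  qed (use carrier_matD[OF mat_adjoint_carrier[OF c]] in auto)
qed

lemma basis_mat_unitary:
  assumes on: "\<And>k l. k < n \<Longrightarrow> l < n \<Longrightarrow> inner_upto n (u k) (u l) = of_bool (k = l)"
  shows "unitary n (basis_mat n u)"
proof -
  have c: "basis_mat n u \<in> carrier_mat n n" by (simp add: basis_mat_def)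
  have "mat_adjoint (basis_mat n u) * basis_mat n u = 1\<^sub>m n"
    unfolding basis_mat_adjoint
    using on
    by (intro eq_matI)
      (auto simp: basis_mat_def scalar_prod_def inner_upto_def atLeast0LessThan
        simp flip: of_real_mult of_real_sum)
  then show ?thesis unfolding unitary_def
    using c mat_mult_left_right_inverse[OF mat_adjoint_carrier[OF c] c] by blast
qed

lemma unitary_conj_basis_mat:
  "unitary_conj n (basis_mat n u) d =
    mat n n (\<lambda>(i, j). complex_of_real (\<Sum>k<n. d k * u k i * u k j))"
proof -
  have "basis_mat n u * mat_diag n (\<lambda>i. complex_of_real (d i))
      = mat n n (\<lambda>(i, k). complex_of_real (u k i * d k))"
    by (subst mat_diag_mult_right[of _ n n]) (auto simp: basis_mat_def intro!: eq_matI)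
  then show ?thesis unfolding unitary_conj_def basis_mat_adjoint
    by (intro eq_matI) (auto simp: scalar_prod_def atLeast0LessThan mult_ac)
qed

lemma selfadjoint_real_symmetric:
  assumes "\<And>i j. i < n \<Longrightarrow> j < n \<Longrightarrow> r i j = r j i"
  shows "selfadjoint (mat n n (\<lambda>(i, j). complex_of_real (r i j)))"
proof -
  let ?A = "mat n n (\<lambda>(i, j). complex_of_real (r i j))"
  have c: "?A \<in> carrier_mat n n" by simp
  show ?thesis unfolding selfadjoint_def
  proof (rule eq_matI)
    show "mat_adjoint ?A $$ (i, j) = ?A $$ (i, j)" if "i < dim_row ?A" "j < dim_col ?A" for i j
      using that assms[of i j] by (simp add: mat_adjoint_index[OF c])
  qed (use carrier_matD[OF mat_adjoint_carrier[OF c]] in auto)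
qed

lemma eigenvalues_unitary_conj:
  assumes U: "unitary n U" and d: "\<And>i. i < n \<Longrightarrow> d i \<in> I"
  shows "eigenvalues_in (unitary_conj n U d) I"
  unfolding eigenvalues_in_def
proof (intro allI impI)
  fix c assume ev: "eigenvalue (unitary_conj n U d) c"
  let ?D = "mat_diag n (\<lambda>i. complex_of_real (d i))" and ?V = "mat_adjoint U"
  have [simp]: "U \<in> carrier_mat n n" "?V \<in> carrier_mat n n" "?D \<in> carrier_mat n n"
    using U by (auto simp: unitary_def intro: mat_adjoint_carrier)
  have A: "unitary_conj n U d \<in> carrier_mat n n"
    unfolding unitary_conj_def by (intro mult_carrier_mat[of _ n n]) simp_all
  obtain v where v: "v \<in> carrier_vec n" "v \<noteq> 0\<^sub>v n" "unitary_conj n U d *\<^sub>v v = c \<cdot>\<^sub>v v"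
    using ev carrier_matD[OF A] unfolding eigenvalue_def eigenvector_def by auto
  define y where "y = ?V *\<^sub>v v"
  have y: "y \<in> carrier_vec n" unfolding y_def using v(1)
      by (intro mult_mat_vec_carrier[of _ n n]) simp_all
  have "U *\<^sub>v y = (U * ?V) *\<^sub>v v" unfolding y_def
    using v(1) by (subst assoc_mult_mat_vec[of _ n n _ n]) simp_all
  then have Uy: "U *\<^sub>v y = v" using U v(1) by (simp add: unitary_def)
  have "?D *\<^sub>v y = (?V * U) *\<^sub>v (?D *\<^sub>v y)" using U y
    by (simp add: unitary_def mult_mat_vec_carrier[of _ n n])
  also have "\<dots> = ?V *\<^sub>v (unitary_conj n U d *\<^sub>v v)"
  proof -
    have "unitary_conj n U d *\<^sub>v v = U *\<^sub>v (?D *\<^sub>v y)"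
      unfolding unitary_conj_def y_def using v(1)
      by (simp add: assoc_mult_mat_vec[of _ n n _ n] mult_carrier_mat[of _ n n] mult_mat_vec_carrier[of _ n n])
    then show ?thesis using y
      by (simp add: assoc_mult_mat_vec[of _ n n _ n] mult_mat_vec_carrier[of _ n n])
  qed
  also have "\<dots> = c \<cdot>\<^sub>v y" unfolding v(3) y_def using v(1) by (intro mult_mat_vec[of _ n n]) simp_all
  finally have Dy: "?D *\<^sub>v y = c \<cdot>\<^sub>v y" .
  have "y \<noteq> 0\<^sub>v n"
  proof
    assume "y = 0\<^sub>v n"
    then have "v = U *\<^sub>v 0\<^sub>v n" using Uy by simp
    also have "\<dots> = 0\<^sub>v n" by (rule eq_vecI) (auto simp: carrier_matD[of U n n] scalar_prod_def)
    finally show False using v(2) by simp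
  qed
  then obtain i where i: "i < n" "y $ i \<noteq> 0"
    using y by (metis carrier_vecD eq_vecI index_zero_vec(1) zero_carrier_vec)
  have "(?D *\<^sub>v y) $ i = (\<Sum>j<n. (if i = j then complex_of_real (d j) else 0) * y $ j)"
    using i(1) y by (simp add: mat_diag_def scalar_prod_def atLeast0LessThan)
  also have "\<dots> = (\<Sum>j<n. if i = j then complex_of_real (d j) * y $ j else 0)"
    by (rule sum.cong) auto
  also have "\<dots> = d i * y $ i" using i(1) by simp
  finally have "c * y $ i = d i * y $ i" using Dy i(1) y by simp
  then show "c \<in> complex_of_real ` I" using i d by auto
qed

lemma real_quadratic_form:
  assumes "A = mat n n (\<lambda>(i, j). complex_of_real (r i j))"
  shows "(A *\<^sub>v vec n (\<lambda>i. complex_of_real (x i))) \<bullet>c vec n (\<lambda>i. complex_of_real (x i))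
    = complex_of_real (\<Sum>i<n. \<Sum>j<n. r i j * x j * x i)"
  using assms by (simp add: scalar_prod_def atLeast0LessThan sum_distrib_right)

text \<open>The quadratic form of \<open>\<Sum>k. d k * u k (u k)\<^sup>T\<close> at \<open>w\<close>.\<close>

lemma sum_rank_one_quadratic:
  "(\<Sum>i<n. \<Sum>j<n. (\<Sum>k<n. d k * u k i * u k j) * w j * w i) = (\<Sum>k<n. (inner_upto n w (u k))\<^sup>2 * d k)"
proof -
  have "(\<Sum>i<n. \<Sum>j<n. (\<Sum>k<n. d k * u k i * u k j) * w j * w i)
      = (\<Sum>i<n. \<Sum>j<n. \<Sum>k<n. d k * ((w i * u k i) * (w j * u k j)))"
    by (simp add: sum_distrib_left sum_distrib_right mult_ac)
  also have "\<dots> = (\<Sum>i<n. \<Sum>k<n. \<Sum>j<n. d k * ((w i * u k i) * (w j * u k j)))"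
    by (intro sum.cong refl sum.swap)
  also have "\<dots> = (\<Sum>k<n. \<Sum>i<n. \<Sum>j<n. d k * ((w i * u k i) * (w j * u k j)))"
    by (rule sum.swap)
  also have "\<dots> = (\<Sum>k<n. (inner_upto n w (u k))\<^sup>2 * d k)"
    by (intro sum.cong refl)
      (simp add: inner_upto_def power2_eq_square sum_product sum_distrib_left[symmetric] mult.commute)
  finally show ?thesis .
qed

lemma sum_int_triple: "(\<Sum>k\<in>{-1, 0, 1::int} \<times> A. F k)
    = (\<Sum>i\<in>A. F (-1, i)) + (\<Sum>i\<in>A. F (0, i)) + (\<Sum>i\<in>A. F (1, i))"
  for F :: "int \<times> 'a \<Rightarrow> real"
  using sum.cartesian_product[of "\<lambda>s i. F (s, i)" A "{-1, 0, 1}"] by simp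

text \<open>Three diagonalised real symmetric matrices, of which number \<open>0\<close> is the midpoint of numbers \<open>1\<close> and
  \<open>-1\<close>, together with a vector \<open>w\<close>, give a test: adding \<open>t\<close> to each matrix translates its spectrum, and
  midpoint convexity is evaluated at \<open>w\<close>.\<close>

lemma convexity_test_of_orthonormal_bases:
  fixes u :: "int \<Rightarrow> nat \<Rightarrow> nat \<Rightarrow> real" and d :: "int \<Rightarrow> nat \<Rightarrow> real"
  assumes on: "\<And>s k l. s \<in> {-1, 0, 1} \<Longrightarrow> k < n \<Longrightarrow> l < n \<Longrightarrow> inner_upto n (u s k) (u s l) = of_bool (k = l)"
    and mid: "\<And>i j. i < n \<Longrightarrow> j < n \<Longrightarrow> (\<Sum>k<n. d 0 k * u 0 k i * u 0 k j)
      = ((\<Sum>k<n. d 1 k * u 1 k i * u 1 k j) + (\<Sum>k<n. d (-1) k * u (-1) k i * u (-1) k j)) / 2"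
  shows "convexity_test n ({-1, 0, 1} \<times> {..<n})
    (\<lambda>(s, k). (if s = 0 then -2 else 1) * (inner_upto n w (u s k))\<^sup>2) (\<lambda>(s, k). d s k)"
  unfolding convexity_test_def
proof (intro conjI allI impI)
  fix f I t
  assume conv: "n_convex_on n I f"
    and I: "\<forall>k\<in>{-1, 0, 1} \<times> {..<n}. t + (case k of (s, k) \<Rightarrow> d s k) \<in> I"
  let ?S = "{-1, 0, 1::int}"
  have S: "0 \<in> ?S" "1 \<in> ?S" "-1 \<in> ?S" by simp_all
  define U where "U = (\<lambda>s. basis_mat n (u s))"
  define A where "A = (\<lambda>s. unitary_conj n (U s) (\<lambda>k. t + d s k))"
  define R where "R = (\<lambda>s i j. \<Sum>k<n. f (t + d s k) * u s k i * u s k j)"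
  have U: "unitary n (U s)" if "s \<in> ?S" for s
    unfolding U_def by (rule basis_mat_unitary) (rule on[OF that])
  have A: "A s = mat n n (\<lambda>(i, j). complex_of_real (\<Sum>k<n. (t + d s k) * u s k i * u s k j))" for s
    by (simp add: A_def U_def unitary_conj_basis_mat)
  have Ac: "A s \<in> carrier_mat n n" for s by (simp add: A)
  have fA: "fun_calc f (A s) = mat n n (\<lambda>(i, j). complex_of_real (R s i j))" if "s \<in> ?S" for s
    unfolding A_def fun_calc_unitary_conj[OF U[OF that]]
    by (simp add: U_def unitary_conj_basis_mat R_def)
  have sa: "selfadjoint (A s)" for s unfolding A
    by (rule selfadjoint_real_symmetric) (simp add: mult_ac)
  have ev: "eigenvalues_in (A s) I" if "s \<in> ?S" for s unfolding A_def
    using I that by (intro eigenvalues_unitary_conj U) auto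
  have compl: "(\<Sum>k<n. t * u s k i * u s k j) = t * of_bool (i = j)" if "s \<in> ?S" "i < n" "j < n"
      for s i j
    using orthonormal_completeness[of n "u s" i j] on[OF that(1)] that
    by (simp add: mult.assoc sum_distrib_left[symmetric])
  have mid': "complex_of_real (1/2) \<cdot>\<^sub>m A 1 + complex_of_real (1 - 1/2) \<cdot>\<^sub>m A (-1) = A 0"
  proof (rule eq_matI)
    fix i j assume "i < dim_row (A 0)" "j < dim_col (A 0)"
    then have ij: "i < n" "j < n" using carrier_matD[OF Ac] by auto
    let ?d = "\<lambda>s. (\<Sum>k<n. d s k * u s k i * u s k j)"
    have e: "A s $$ (i, j) = complex_of_real (t * of_bool (i = j) + ?d s)" if "s \<in> ?S" for s
    proof -
      have "(\<Sum>k<n. (t + d s k) * u s k i * u s k j) = t * of_bool (i = j) + ?d s"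
        using compl[OF that ij] by (simp add: distrib_right sum.distrib)
      moreover have "A s $$ (i, j) = complex_of_real (\<Sum>k<n. (t + d s k) * u s k i * u s k j)"
        using ij by (simp add: A del: of_real_sum of_real_mult of_real_add)
      ultimately show ?thesis by (simp only:)
    qed
    have "(complex_of_real (1/2) \<cdot>\<^sub>m A 1 + complex_of_real (1 - 1/2) \<cdot>\<^sub>m A (-1)) $$ (i, j)
      = complex_of_real (1/2) * A 1 $$ (i, j) + complex_of_real (1/2) * A (-1) $$ (i, j)"
      using ij carrier_matD[OF Ac] by simp
    also have "\<dots> = complex_of_real (t * of_bool (i = j) + (?d 1 + ?d (-1)) / 2)"
      unfolding e[OF S(2)] e[OF S(3)] of_real_mult[symmetric] of_real_add[symmetric] of_real_eq_iff
      by (simp add: field_simps)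
    also have "\<dots> = A 0 $$ (i, j)" unfolding mid[OF ij, symmetric] e[OF S(1)] ..
    finally show "(complex_of_real (1/2) \<cdot>\<^sub>m A 1 + complex_of_real (1 - 1/2) \<cdot>\<^sub>m A (-1)) $$ (i, j)
        = A 0 $$ (i, j)" .
  qed (use carrier_matD[OF Ac] in auto)
  define M where "M = mat n n (\<lambda>(i, j). complex_of_real ((R 1 i j + R (-1) i j) / 2 - R 0 i j))"
  have "loewner_le (fun_calc f (A 0))
      (complex_of_real (1/2) \<cdot>\<^sub>m fun_calc f (A 1) + complex_of_real (1 - 1/2) \<cdot>\<^sub>m fun_calc f (A (-1)))"
    using conv[unfolded n_convex_on_def, rule_format, of "A 1" "A (-1)" "1/2"] Ac sa ev
    unfolding mid' by simp
  also have "complex_of_real (1/2) \<cdot>\<^sub>m fun_calc f (A 1)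
      + complex_of_real (1 - 1/2) \<cdot>\<^sub>m fun_calc f (A (-1))
      = mat n n (\<lambda>(i, j). complex_of_real ((R 1 i j + R (-1) i j) / 2))"
    by (rule eq_matI) (auto simp: fA field_simps)
  finally have "pos_semidef (mat n n (\<lambda>(i, j). complex_of_real ((R 1 i j + R (-1) i j) / 2)) - fun_calc f (A 0))"
    by (simp add: loewner_le_def)
  also have "mat n n (\<lambda>(i, j). complex_of_real ((R 1 i j + R (-1) i j) / 2)) - fun_calc f (A 0) = M"
    unfolding M_def by (rule eq_matI) (auto simp: fA)
  finally have M: "pos_semidef M" .
  define x where "x = vec n (\<lambda>i. complex_of_real (w i))"
  have "0 \<le> (M *\<^sub>v x) \<bullet>c x" using M unfolding pos_semidef_def by (auto simp: M_def x_def)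
  then have "0 \<le> (\<Sum>i<n. \<Sum>j<n. ((R 1 i j + R (-1) i j) / 2 - R 0 i j) * w j * w i)"
    unfolding x_def real_quadratic_form[OF M_def] by (simp add: less_eq_complex_def)
  also have "\<dots> = ((\<Sum>i<n. \<Sum>j<n. R 1 i j * w j * w i) + (\<Sum>i<n. \<Sum>j<n. R (-1) i j * w j * w i)) / 2
      - (\<Sum>i<n. \<Sum>j<n. R 0 i j * w j * w i)"
    by (simp add: left_diff_distrib add_divide_distrib distrib_right sum_subtractf sum.distrib sum_divide_distrib)
  finally have "0 \<le> (\<Sum>k<n. (inner_upto n w (u 1 k))\<^sup>2 * f (t + d 1 k))
      + (\<Sum>k<n. (inner_upto n w (u (-1) k))\<^sup>2 * f (t + d (-1) k))
      - 2 * (\<Sum>k<n. (inner_upto n w (u 0 k))\<^sup>2 * f (t + d 0 k))"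
    unfolding R_def sum_rank_one_quadratic by simp
  then show "0 \<le> (\<Sum>k\<in>?S \<times> {..<n}. (case k of (s, k) \<Rightarrow> (if s
      = 0 then -2 else 1) * (inner_upto n w (u s k))\<^sup>2)
      * f (t + (case k of (s, k) \<Rightarrow> d s k)))"
    unfolding sum_int_triple by (simp add: sum_distrib_left sum_negf mult.assoc)
qed simp

section \<open>Tests with prescribed moments\<close>

lemma parseval:
  assumes on: "\<And>k l. k < n \<Longrightarrow> l < n \<Longrightarrow> inner_upto n (u k) (u l) = of_bool (k = l)"
  shows "inner_upto n x y = (\<Sum>k<n. inner_upto n x (u k) * inner_upto n y (u k))"
proof -
  have "(\<Sum>k<n. inner_upto n x (u k) * inner_upto n y (u k))
      = (\<Sum>k<n. \<Sum>i<n. \<Sum>j<n. (x i * y j) * (u k i * u k j))"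
    unfolding inner_upto_def sum_product by (simp add: mult_ac)
  also have "\<dots> = (\<Sum>i<n. \<Sum>k<n. \<Sum>j<n. (x i * y j) * (u k i * u k j))" by (rule sum.swap)
  also have "\<dots> = (\<Sum>i<n. \<Sum>j<n. \<Sum>k<n. (x i * y j) * (u k i * u k j))"
    by (intro sum.cong refl sum.swap)
  also have "\<dots> = (\<Sum>i<n. \<Sum>j<n. if i = j then x i * y j else 0)"
    unfolding sum_distrib_left[symmetric]
    by (intro sum.cong refl) (simp add: orthonormal_completeness[OF on])
  also have "\<dots> = inner_upto n x y" by (simp add: inner_upto_def)
  finally show ?thesis ..
qed

text \<open>The weights \<open>(inner_upto n w (u l))\<^sup>2\<close> at the eigenvalues form the spectral measure of \<open>w\<close>; its
  moments are \<open>\<langle>(J s)\<^bsup>k\<^esup> w, w\<rangle>\<close>.\<close>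

lemma eigenbasis_moment:
  assumes ev: "\<And>k i. k < n \<Longrightarrow> i < n \<Longrightarrow> path_op n s (u k) i = \<mu> k * u k i"
    and on: "\<And>k l. k < n \<Longrightarrow> l < n \<Longrightarrow> inner_upto n (u k) (u l) = of_bool (k = l)"
  shows "(\<Sum>l<n. (inner_upto n w (u l))\<^sup>2 * \<mu> l ^ k) = inner_upto n ((path_op n s ^^ k) w) w"
proof -
  have "inner_upto n ((path_op n s ^^ k) w) (u l) = \<mu> l ^ k * inner_upto n w (u l)" if l: "l < n" for l
  proof (induction k)
    case (Suc k)
    have "inner_upto n ((path_op n s ^^ Suc k) w) (u l)
        = inner_upto n ((path_op n s ^^ k) w) (path_op n s (u l))"
      by (simp add: path_op_symmetric)
    also have "\<dots> = \<mu> l * inner_upto n ((path_op n s ^^ k) w) (u l)"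
      unfolding inner_upto_def sum_distrib_left by (intro sum.cong) (auto simp: ev l)
    finally show ?case by (simp add: Suc.IH)
  qed simp
  then show ?thesis
    by (subst parseval[OF on]) (auto simp: power2_eq_square intro!: sum.cong)
qed

text \<open>The limit of the telescoped second difference, in which only the terms with \<open>q = 0\<close> survive.\<close>

lemma convolution_reindex:
  fixes c :: "nat \<Rightarrow> real"
  assumes c: "\<And>i. i \<ge> n \<Longrightarrow> c i = 0"
  shows "(\<Sum>p<k. \<Sum>q<p. c (k - 1 - p) * of_bool (q = 0) * c (p - 1 - q))
    = (\<Sum>i<n. \<Sum>j<n. c i * c j * of_bool (i + j + 2 = k))"
proof (cases k)
  case (Suc m)
  define N where "N = n + m"
  have inner: "(\<Sum>q<p. c (k - 1 - p) * of_bool (q = 0) * c (p - 1 - q)) = (if p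
      = 0 then 0 else c (k - 1 - p) * c (p - 1))" for p
    by (cases p) (auto simp: sum.lessThan_Suc_shift simp del: sum.lessThan_Suc)
  have "(\<Sum>p<k. \<Sum>q<p. c (k - 1 - p) * of_bool (q = 0) * c (p - 1 - q)) = (\<Sum>j<m. c (m - 1 - j) * c j)"
    unfolding inner by (simp add: Suc sum.lessThan_Suc_shift del: sum.lessThan_Suc)
  also have "\<dots> = (\<Sum>j<N. if j < m then c (m - 1 - j) * c j else 0)"
    by (rule sum.mono_neutral_cong_left) (auto simp: N_def)
  also have "\<dots> = (\<Sum>j<N. \<Sum>i<N. if i = m - 1 - j then (if j < m then c i * c j else 0) else 0)"
    by (intro sum.cong refl) (auto simp: N_def)
  also have "\<dots> = (\<Sum>j<N. \<Sum>i<N. c i * c j * of_bool (i + j + 2 = k))"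
    by (intro sum.cong refl) (auto simp: Suc)
  also have "\<dots> = (\<Sum>i<N. \<Sum>j<N. c i * c j * of_bool (i + j + 2 = k))" by (rule sum.swap)
  also have "\<dots> = (\<Sum>i<n. \<Sum>j<N. c i * c j * of_bool (i + j + 2 = k))"
    by (rule sum.mono_neutral_right) (auto simp: N_def c)
  also have "\<dots> = (\<Sum>i<n. \<Sum>j<n. c i * c j * of_bool (i + j + 2 = k))"
    by (intro sum.cong refl sum.mono_neutral_right) (auto simp: N_def c)
  finally show ?thesis .
qed simp

text \<open>The test vector.  Its powers of \<open>h\<close> are matched to \<open>path_op_pow_e0\<close>: in
  \<open>h\<^bsup>p\<^esup> ((J s)\<^bsup>p\<^esup> w) 0\<close> the coordinate \<open>p\<close> of \<open>w\<close> carries the factor \<open>h\<^bsup>n-1\<^esup>\<close>, the coordinates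
  before it a higher power of \<open>h\<close>, and those after it do not contribute.\<close>

definition scaled_vec :: "nat \<Rightarrow> (nat \<Rightarrow> real) \<Rightarrow> real \<Rightarrow> nat \<Rightarrow> real" where
  "scaled_vec n c h i = h ^ (n - 1 - i) * c i"

lemma scaled_path_op_limit:
  assumes n: "n > 0" and c: "\<And>i. i \<ge> n \<Longrightarrow> c i = 0"
  shows "((\<lambda>h. h ^ p * (path_op n s ^^ p) (scaled_vec n c h) 0 / h ^ (n - 1)) \<longlongrightarrow> c p) (at_right 0)"
proof -
  define \<gamma> where "\<gamma> = (path_op n s ^^ p) e0"
  have \<gamma>: "\<gamma> i = 0" if "i > p" for i
    using path_op_pow_e0[of p i n s] that by (simp add: \<gamma>_def)
  have \<gamma>p: "\<gamma> p = 1" if "p < n"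
    using path_op_pow_e0[of p p n s] that by (simp add: \<gamma>_def)
  have eq: "h ^ p * (path_op n s ^^ p) (scaled_vec n c h) 0 / h ^ (n - 1)
      = (\<Sum>i<n. c i * \<gamma> i * h ^ (p - i))"
    if h: "h > 0" for h
  proof -
    have "h ^ p * (path_op n s ^^ p) (scaled_vec n c h) 0 / h ^ (n - 1)
        = (\<Sum>i<n. h ^ p * (h ^ (n - 1 - i) * c i * \<gamma> i) / h ^ (n - 1))"
      by (simp add: path_op_pow_0[OF n] \<gamma>_def inner_upto_def scaled_vec_def sum_distrib_left sum_divide_distrib)
    also have "\<dots> = (\<Sum>i<n. c i * \<gamma> i * h ^ (p - i))"
    proof (intro sum.cong refl)
      fix i assume "i \<in> {..<n}"
      then have i: "i < n" by simp
      show "h ^ p * (h ^ (n - 1 - i) * c i * \<gamma> i) / h ^ (n - 1) = c i * \<gamma> i * h ^ (p - i)"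
      proof (cases "i \<le> p")
        case True
        have "h ^ p = h ^ (p - i) * h ^ i" using True by (simp flip: power_add)
        moreover have "h ^ (n - 1) = h ^ i * h ^ (n - 1 - i)" using i by (simp flip: power_add)
        ultimately show ?thesis using h by simp
      qed (simp add: \<gamma>)
    qed
    finally show ?thesis .
  qed
  have "((\<lambda>h. \<Sum>i<n. c i * \<gamma> i * h ^ (p - i)) \<longlongrightarrow> (\<Sum>i<n. c i * \<gamma> i * 0 ^ (p - i))) (at_right 0)"
    by (intro tendsto_intros)
  also have "(\<Sum>i<n. c i * \<gamma> i * 0 ^ (p - i)) = (\<Sum>i<n. if i = p then c i else 0)"
    by (intro sum.cong refl) (use \<gamma> \<gamma>p in \<open>auto simp: power_0_left not_less\<close>)
  also have "\<dots> = c p" using c[of p] by auto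
  finally show ?thesis
    by (rule Lim_transform_eventually)
      (rule eventually_mono[OF eventually_at_right_less], simp only: eq)
qed

lemma scaled_second_diff_limit:
  assumes n: "n > 0" and c: "\<And>i. i \<ge> n \<Longrightarrow> c i = 0"
  defines "D \<equiv> \<lambda>k w. inner_upto n ((path_op n 1 ^^ k) w) w + inner_upto n ((path_op n (-1) ^^ k) w) w
      - 2 * inner_upto n ((path_op n 0 ^^ k) w) w"
  shows "((\<lambda>h. h ^ k * D k (scaled_vec n c h) / h ^ (2 * n)) \<longlongrightarrow>
    2 * (\<Sum>i<n. \<Sum>j<n. c i * c j * of_bool (i + j + 2 = k))) (at_right 0)"
proof -
  define S where "S = (\<lambda>s p h. h ^ p * (path_op n s ^^ p) (scaled_vec n c h) 0 / h ^ (n - 1))"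
  define \<gamma> where "\<gamma> = (\<lambda>q. (path_op n 1 ^^ q) e0 0)"
  have S: "(S s p \<longlongrightarrow> c p) (at_right 0)" for s p
    unfolding S_def by (rule scaled_path_op_limit[OF n c])
  have g: "((\<lambda>h. \<gamma> q * h ^ q) \<longlongrightarrow> of_bool (q = 0)) (at_right 0)" for q
  proof -
    have "((\<lambda>h. \<gamma> q * h ^ q) \<longlongrightarrow> \<gamma> q * 0 ^ q) (at_right 0)" by (intro tendsto_intros)
    also have "\<gamma> q * 0 ^ q = of_bool (q = 0)" by (auto simp: \<gamma>_def power_0_left)
    finally show ?thesis .
  qed
  have eq: "h ^ k * D k (scaled_vec n c h) / h ^ (2 * n)
      = 2 * (\<Sum>p<k. \<Sum>q<p. S 0 (k - 1 - p) h * (\<gamma> q * h ^ q) * S (-1) (p - 1 - q) h)" if h: "h > 0" for h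
  proof -
    let ?b = "\<lambda>s p. (path_op n s ^^ p) (scaled_vec n c h) 0"
    have "h ^ k * (?b 0 (k - 1 - p) * \<gamma> q * ?b (-1) (p - 1 - q)) / h ^ (2 * n)
        = S 0 (k - 1 - p) h * (\<gamma> q * h ^ q) * S (-1) (p - 1 - q) h" if "p < k" "q < p" for p q
    proof -
      \<comment> \<open>the exponents of the three factors add up to \<open>k - 2\<close>\<close>
      have k: "h ^ k = h\<^sup>2 * h ^ (k - 1 - p) * h ^ q * h ^ (p - 1 - q)"
      proof -
        have "k = 2 + (k - 1 - p) + q + (p - 1 - q)" using that by simp
        then show ?thesis by (metis power_add)
      qed
      have n2: "h ^ (2 * n) = h\<^sup>2 * h ^ (n - 1) * h ^ (n - 1)"
      proof -
        have "2 * n = 2 + (n - 1) + (n - 1)" using n by simp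
        then show ?thesis by (metis power_add)
      qed
      show ?thesis unfolding k n2 S_def using h by (simp add: field_simps)
    qed
    then have XS: "(\<Sum>p<k. \<Sum>q<p. h ^ k * (?b 0 (k - 1 - p) * \<gamma> q * ?b (-1) (p - 1 - q)) / h ^ (2 * n))
      = (\<Sum>p<k. \<Sum>q<p. S 0 (k - 1 - p) h * (\<gamma> q * h ^ q) * S (-1) (p - 1 - q) h)"
      by (intro sum.cong refl) auto
    have "h ^ k * D k (scaled_vec n c h) / h ^ (2 * n)
        = 2 * (h ^ k * (\<Sum>p<k. \<Sum>q<p. ?b 0 (k - 1 - p) * \<gamma> q * ?b (-1) (p - 1 - q)) / h ^ (2 * n))"
      unfolding D_def path_op_second_diff[OF n] \<gamma>_def by simp
    also have "\<dots> = 2 * (\<Sum>p<k. \<Sum>q<p. h ^ k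
        * (?b 0 (k - 1 - p) * \<gamma> q * ?b (-1) (p - 1 - q)) / h ^ (2 * n))"
      unfolding sum_distrib_left sum_divide_distrib ..
    finally show ?thesis unfolding XS .
  qed
  have "((\<lambda>h. 2 * (\<Sum>p<k. \<Sum>q<p. S 0 (k - 1 - p) h * (\<gamma> q * h ^ q) * S (-1) (p - 1 - q) h)) \<longlongrightarrow>
      2 * (\<Sum>p<k. \<Sum>q<p. c (k - 1 - p) * of_bool (q = 0) * c (p - 1 - q))) (at_right 0)"
    by (intro tendsto_intros S g)
  then have "((\<lambda>h. 2 * (\<Sum>p<k. \<Sum>q<p. S 0 (k - 1 - p) h * (\<gamma> q * h ^ q) * S (-1) (p - 1 - q) h)) \<longlongrightarrow>
      2 * (\<Sum>i<n. \<Sum>j<n. c i * c j * of_bool (i + j + 2 = k))) (at_right 0)"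
    by (simp only: convolution_reindex[of n c k, OF c])
  then show ?thesis
    by (rule Lim_transform_eventually)
      (rule eventually_mono[OF eventually_at_right_less], simp only: eq)
qed

text \<open>For every \<open>c\<close> there are tests, depending on a scale \<open>h\<close>, with nodes of size \<open>O(h)\<close>, bounded
  weights, and \<open>m\<close>-th moment asymptotic to \<open>2 h\<^bsup>2n\<^esup> \<Sum>i+j+2=m. c i * c j\<close>.\<close>

lemma convexity_tests_with_moments:
  fixes c :: "nat \<Rightarrow> real"
  assumes n: "n > 0" and c: "\<And>i. i \<ge> n \<Longrightarrow> c i = 0"
  obtains a p :: "real \<Rightarrow> int \<times> nat \<Rightarrow> real" and K and C :: real where
    "finite K" "\<And>h. convexity_test n K (a h) (p h)"
    "\<And>h k. h > 0 \<Longrightarrow> k \<in> K \<Longrightarrow> \<bar>p h k\<bar> \<le> 2 * h"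
    "\<And>h. 0 < h \<Longrightarrow> h \<le> 1 \<Longrightarrow> (\<Sum>k\<in>K. \<bar>a h k\<bar>) \<le> C"
    "\<And>m. ((\<lambda>h. (\<Sum>k\<in>K. a h k * p h k ^ m) / h ^ (2 * n)) \<longlongrightarrow>
      2 * (\<Sum>i<n. \<Sum>j<n. c i * c j * of_bool (i + j + 2 = m))) (at_right 0)"
proof -
  let ?S = "{-1, 0, 1::int}"
  have "\<forall>s\<in>?S. \<exists>u \<mu>. (\<forall>k<n. \<bar>\<mu> k\<bar> \<le> 2) \<and> (\<forall>k<n. \<forall>i<n. path_op n (real_of_int s) (u k) i = \<mu> k * u k i)
      \<and> (\<forall>k<n. \<forall>l<n. inner_upto n (u k) (u l) = of_bool (k = l))"
  proof
    fix s assume "s \<in> ?S"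
    then have s: "real_of_int s \<in> {-1, 0, 1}" by auto
    show "\<exists>u \<mu>. (\<forall>k<n. \<bar>\<mu> k\<bar> \<le> 2) \<and> (\<forall>k<n. \<forall>i<n. path_op n (real_of_int s) (u k) i = \<mu> k * u k i)
      \<and> (\<forall>k<n. \<forall>l<n. inner_upto n (u k) (u l) = of_bool (k = l))"
      by (rule path_op_orthonormal_eigenbasis[OF s, of n]) blast
  qed
  then obtain u \<mu> where \<mu>: "\<And>s k. s \<in> ?S \<Longrightarrow> k < n \<Longrightarrow> \<bar>\<mu> s k\<bar> \<le> 2"
    and ev: "\<And>s k i. s \<in> ?S \<Longrightarrow> k < n \<Longrightarrow> i < n \<Longrightarrow> path_op n (real_of_int s) (u s k) i = \<mu> s k * u s k i"
    and on: "\<And>s k l. s \<in> ?S \<Longrightarrow> k < n \<Longrightarrow> l < n \<Longrightarrow> inner_upto n (u s k) (u s l) = of_bool (k = l)"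
    unfolding bchoice_iff by metis
  define w where "w = scaled_vec n c"
  define a where "a = (\<lambda>h (s, k). (if s = 0 then -2 else 1) * (inner_upto n (w h) (u s k))\<^sup>2)"
  define p where "p = (\<lambda>h (s, k). h * \<mu> s k)"
  let ?K = "?S \<times> {..<n}"
  have resolution: "(\<Sum>k<n. \<mu> s k * u s k i * u s k j) = path_op n s (\<lambda>l. of_bool (l = j)) i"
    if s: "s \<in> ?S" and i: "i < n" and j: "j < n" for s i j
  proof -
    have cmp: "(\<Sum>k<n. u s k l * u s k j) = of_bool (l = j)" if "l < n" for l
      by (rule orthonormal_completeness[OF on[OF s] that j])
    have "(\<Sum>k<n. \<mu> s k * u s k i * u s k j) = (\<Sum>k<n. path_op n s (u s k) i * u s k j)"
      by (intro sum.cong refl) (simp add: ev[OF s _ i])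
    also have "\<dots> = (if i = 0 then s * (\<Sum>k<n. u s k 0 * u s k j) else (\<Sum>k<n. u s k (i - 1) * u s k j))
        + (if Suc i < n then (\<Sum>k<n. u s k (Suc i) * u s k j) else 0)"
      unfolding path_op_def distrib_right sum.distrib
      by (auto simp: sum_distrib_left mult.assoc)
    also have "\<dots> = path_op n s (\<lambda>l. of_bool (l = j)) i"
      unfolding path_op_def using cmp i by auto
    finally show ?thesis .
  qed
  have mid: "(\<Sum>k<n. h * \<mu> 0 k * u 0 k i * u 0 k j)
      = ((\<Sum>k<n. h * \<mu> 1 k * u 1 k i * u 1 k j) + (\<Sum>k<n. h * \<mu> (-1) k * u (-1) k i * u (-1) k j)) / 2"
    if "i < n" "j < n" for i j h
  proof -
    have "(\<Sum>k<n. h * \<mu> s k * u s k i * u s k j) = h * path_op n s (\<lambda>l. of_bool (l = j)) i"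
        if "s \<in> ?S" for s
      unfolding resolution[OF that \<open>i < n\<close> \<open>j < n\<close>, symmetric]
          by (simp add: sum_distrib_left mult.assoc)
    from this[of 0] this[of 1] this[of "-1"] show ?thesis by (simp add: path_op_def algebra_simps)
  qed
  have moments: "(\<Sum>k\<in>?K. a h k * p h k ^ m) = h ^ m * (inner_upto n ((path_op n 1 ^^ m) (w h)) (w h)
      + inner_upto n ((path_op n (-1) ^^ m) (w h)) (w h) - 2 * inner_upto n ((path_op n 0 ^^ m) (w h)) (w h))" for h m
  proof -
    have "(\<Sum>k<n. (inner_upto n (w h) (u s k))\<^sup>2 * (h * \<mu> s k) ^ m)
        = h ^ m * inner_upto n ((path_op n s ^^ m) (w h)) (w h)"
      if s: "s \<in> ?S" for s
    proof -
      have "(\<Sum>k<n. (inner_upto n (w h) (u s k))\<^sup>2 * (h * \<mu> s k) ^ m)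
          = h ^ m * (\<Sum>k<n. (inner_upto n (w h) (u s k))\<^sup>2 * \<mu> s k ^ m)"
        by (simp add: power_mult_distrib sum_distrib_left mult_ac)
      then show ?thesis by (simp add: eigenbasis_moment[OF ev[OF s] on[OF s]])
    qed
    note mom = this[of "-1"] this[of 0] this[of 1]
    have "(\<Sum>k\<in>?K. a h k * p h k ^ m)
        = (\<Sum>k<n. (inner_upto n (w h) (u (-1) k))\<^sup>2 * (h * \<mu> (-1) k) ^ m)
          - 2 * (\<Sum>k<n. (inner_upto n (w h) (u 0 k))\<^sup>2 * (h * \<mu> 0 k) ^ m)
          + (\<Sum>k<n. (inner_upto n (w h) (u 1 k))\<^sup>2 * (h * \<mu> 1 k) ^ m)"
      unfolding sum_int_triple a_def p_def by (simp add: sum_distrib_left sum_negf mult.assoc)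
    then show ?thesis using mom by (simp add: algebra_simps)
  qed
  show thesis
  proof (rule that[of ?K a p "4 * (\<Sum>i<n. (c i)\<^sup>2)"])
    show "convexity_test n ?K (a h) (p h)" for h
      unfolding a_def p_def
      using convexity_test_of_orthonormal_bases[of n u "\<lambda>s k. h * \<mu> s k" "w h", OF on mid] by simp
    show "\<bar>p h k\<bar> \<le> 2 * h" if "h > 0" "k \<in> ?K" for h k
      using that \<mu>[of "fst k" "snd k"] by (auto simp: p_def abs_mult)
    show "(\<Sum>k\<in>?K. \<bar>a h k\<bar>) \<le> 4 * (\<Sum>i<n. (c i)\<^sup>2)" if h: "0 < h" "h \<le> 1" for h
    proof -
      have "(\<Sum>k<n. (inner_upto n (w h) (u s k))\<^sup>2) = inner_upto n (w h) (w h)" if s: "s \<in> ?S" for s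
        using eigenbasis_moment[OF ev[OF s] on[OF s], of "w h" 0] by simp
      from this[of 0] this[of 1] this[of "-1"]
      have "(\<Sum>k\<in>?K. \<bar>a h k\<bar>) = 4 * inner_upto n (w h) (w h)"
        unfolding sum_int_triple a_def by (simp add: abs_mult sum_distrib_left[symmetric])
      also have "inner_upto n (w h) (w h) \<le> (\<Sum>i<n. (c i)\<^sup>2)"
        unfolding inner_upto_def w_def scaled_vec_def
      proof (rule sum_mono)
        fix i
        have "(h ^ (n - 1 - i))\<^sup>2 * (c i)\<^sup>2 \<le> 1 * (c i)\<^sup>2"
          using h by (intro mult_right_mono) (auto simp: power_le_one)
        then show "h ^ (n - 1 - i) * c i * (h ^ (n - 1 - i) * c i) \<le> (c i)\<^sup>2"
          by (simp add: power2_eq_square mult_ac)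
      qed
      finally show ?thesis by simp
    qed
    show "((\<lambda>h. (\<Sum>k\<in>?K. a h k * p h k ^ m) / h ^ (2 * n)) \<longlongrightarrow>
      2 * (\<Sum>i<n. \<Sum>j<n. c i * c j * of_bool (i + j + 2 = m))) (at_right 0)" for m
      unfolding moments w_def by (rule scaled_second_diff_limit[OF n c])
  qed simp
qed

section \<open>Positivity of the local Hankel form\<close>

lemma Ck_on_open_has_derivative:
  assumes "Ck_on_open m S f" "j < m" "t \<in> S"
  shows "((deriv ^^ j) f has_real_derivative (deriv ^^ Suc j) f t) (at t)"
proof -
  have "(deriv ^^ j) f field_differentiable (at t)" using assms unfolding Ck_on_open_def by blast
  then show ?thesis by (simp add: DERIV_deriv_iff_field_differentiable)
qed

lemma Ck_on_open_taylor:
  assumes Ck: "Ck_on_open m S f" and S: "open S" "t \<in> S" and m: "m > 0" and e: "e > 0"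
  obtains d where "d > 0" "\<And>x. \<bar>x\<bar> < d \<Longrightarrow>
    \<bar>f (t + x) - (\<Sum>k\<le>m. (deriv ^^ k) f t / fact k * x ^ k)\<bar> \<le> e * \<bar>x\<bar> ^ m"
proof -
  let ?D = "\<lambda>k. (deriv ^^ k) f"
  obtain r where r: "r > 0" "ball t r \<subseteq> S" using S openE by blast
  have "isCont (?D m) t"
    using Ck S unfolding Ck_on_open_def by (simp add: continuous_on_eq_continuous_at)
  then obtain d0 where d0: "d0 > 0" "\<And>y. dist y t < d0 \<Longrightarrow> dist (?D m y) (?D m t) < e"
    using e unfolding continuous_at_eps_delta by blast
  define d where "d = min r d0"
  show thesis
  proof (rule that[of d])
    show "d > 0" using r(1) d0(1) by (simp add: d_def)
    fix x :: real assume x: "\<bar>x\<bar> < d"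
    have split: "(\<Sum>k\<le>m. ?D k t / fact k * x ^ k)
        = (\<Sum>k<m. ?D k t / fact k * x ^ k) + ?D m t / fact m * x ^ m"
      by (simp add: lessThan_Suc_atMost[symmetric])
    show "\<bar>f (t + x) - (\<Sum>k\<le>m. ?D k t / fact k * x ^ k)\<bar> \<le> e * \<bar>x\<bar> ^ m"
    proof (cases "x = 0")
      case True
      have at0: "(\<Sum>k\<le>m. ?D k t / fact k * 0 ^ k) = (\<Sum>k\<le>m. if k = 0 then f t else 0)"
        by (intro sum.cong refl) (auto simp: power_0_left)
      show ?thesis unfolding True at0 using m e by simp
    next
      case False
      have "\<exists>\<xi>. (if t + x < t then t + x < \<xi> \<and> \<xi> < t else t < \<xi> \<and> \<xi> < t + x) \<and>
        f (t + x) = (\<Sum>k<m. ?D k t / fact k * (t + x - t) ^ k) + ?D m \<xi> / fact m * (t + x - t) ^ m"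
      proof (rule Taylor[of m ?D f "t - \<bar>x\<bar>" "t + \<bar>x\<bar>"])
        show "\<forall>j u. j < m \<and> t - \<bar>x\<bar> \<le> u \<and> u \<le> t + \<bar>x\<bar> \<longrightarrow> (?D j has_real_derivative ?D (Suc j) u) (at u)"
        proof (intro allI impI)
          fix j u assume a: "j < m \<and> t - \<bar>x\<bar> \<le> u \<and> u \<le> t + \<bar>x\<bar>"
          then have "\<bar>u - t\<bar> < r" using x by (auto simp: d_def)
          then have "u \<in> S" using r(2) by (auto simp: dist_real_def abs_minus_commute)
          then show "(?D j has_real_derivative ?D (Suc j) u) (at u)"
            using Ck_on_open_has_derivative[OF Ck] a by blast
        qed
      qed (use m False in auto)
      then obtain \<xi> where between: "if t + x < t then t + x < \<xi> \<and> \<xi> < t else t < \<xi> \<and> \<xi> < t + x"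
        and eq: "f (t + x) = (\<Sum>k<m. ?D k t / fact k * x ^ k) + ?D m \<xi> / fact m * x ^ m"
        by auto
      have \<xi>: "\<bar>\<xi> - t\<bar> < \<bar>x\<bar>" using between by (auto split: if_splits)
      have "\<bar>?D m \<xi> - ?D m t\<bar> \<le> e"
        using d0(2)[of \<xi>] \<xi> x by (auto simp: dist_real_def d_def)
      moreover have "\<bar>?D m \<xi> - ?D m t\<bar> / fact m \<le> \<bar>?D m \<xi> - ?D m t\<bar>"
        by (simp add: divide_le_eq mult_le_cancel_left1)
      ultimately have "\<bar>(?D m \<xi> - ?D m t) / fact m\<bar> \<le> e" by simp
      then have "\<bar>(?D m \<xi> - ?D m t) / fact m\<bar> * \<bar>x\<bar> ^ m \<le> e * \<bar>x\<bar> ^ m"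
        by (rule mult_right_mono) simp
      moreover have "f (t + x) - (\<Sum>k\<le>m. ?D k t / fact k * x ^ k) = (?D m \<xi> - ?D m t) / fact m * x ^ m"
        unfolding split eq by (simp add: diff_divide_distrib left_diff_distrib)
      ultimately show ?thesis by (simp only: abs_mult power_abs)
    qed
  qed
qed

lemma sum_convolution:
  fixes F c :: "nat \<Rightarrow> real"
  shows "(\<Sum>k\<le>2 * n. F k * (\<Sum>i<n. \<Sum>j<n. c i * c j * of_bool (i + j + 2 = k)))
    = (\<Sum>i<n. \<Sum>j<n. c i * c j * F (i + j + 2))"
proof -
  have "(\<Sum>k\<le>2 * n. F k * (\<Sum>i<n. \<Sum>j<n. c i * c j * of_bool (i + j + 2 = k)))
      = (\<Sum>k\<le>2 * n. \<Sum>i<n. \<Sum>j<n. c i * c j * (if i + j + 2 = k then F k else 0))"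
    unfolding sum_distrib_left by (intro sum.cong refl) auto
  also have "\<dots> = (\<Sum>i<n. \<Sum>k\<le>2 * n. \<Sum>j<n. c i * c j * (if i + j + 2 = k then F k else 0))"
    by (rule sum.swap)
  also have "\<dots> = (\<Sum>i<n. \<Sum>j<n. \<Sum>k\<le>2 * n. c i * c j * (if i + j + 2 = k then F k else 0))"
    by (intro sum.cong refl sum.swap)
  also have "\<dots> = (\<Sum>i<n. \<Sum>j<n. c i * c j * F (i + j + 2))"
    unfolding sum_distrib_left[symmetric] by (intro sum.cong refl) simp
  finally show ?thesis .
qed

text \<open>The Taylor polynomial of degree \<open>2n\<close> sees only the moments up to \<open>2n\<close>, and the remainder
  contributes \<open>o(h\<^bsup>2n\<^esup>)\<close> because the nodes are \<open>O(h)\<close> and the weights bounded.\<close>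

proposition hankel_form_nonneg:
  assumes tests: "passes_convexity_tests n S f" and S: "open S'" "S' \<subseteq> S" "t \<in> S'"
    and Ck: "Ck_on_open (2 * n) S' f"
  shows "0 \<le> (\<Sum>i<n. \<Sum>j<n. c i * c j * ((deriv ^^ (i + j + 2)) f t / fact (i + j + 2)))"
proof (cases "n = 0")
  case False
  then have n: "n > 0" by simp
  \<comment> \<open>extension of the coefficients by zero\<close>
  define b where "b = (\<lambda>i. if i < n then c i else 0)"
  define F where "F = (\<lambda>k. (deriv ^^ k) f t / fact k)"
  define Q where "Q = (\<Sum>i<n. \<Sum>j<n. b i * b j * F (i + j + 2))"
  have b0: "b i = 0" if "i \<ge> n" for i using that by (simp add: b_def)
  obtain a p :: "real \<Rightarrow> int \<times> nat \<Rightarrow> real" and K and C :: real where K: "finite K"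
    and ct: "\<And>h. convexity_test n K (a h) (p h)"
    and p: "\<And>h k. h > 0 \<Longrightarrow> k \<in> K \<Longrightarrow> \<bar>p h k\<bar> \<le> 2 * h"
    and C: "\<And>h. 0 < h \<Longrightarrow> h \<le> 1 \<Longrightarrow> (\<Sum>k\<in>K. \<bar>a h k\<bar>) \<le> C"
    and mom: "\<And>m. ((\<lambda>h. (\<Sum>k\<in>K. a h k * p h k ^ m) / h ^ (2 * n)) \<longlongrightarrow>
      2 * (\<Sum>i<n. \<Sum>j<n. b i * b j * of_bool (i + j + 2 = m))) (at_right 0)"
    by (rule convexity_tests_with_moments[of n b]) (rule n, erule b0, rule that)
  define M where "M = (\<lambda>h m. \<Sum>k\<in>K. a h k * p h k ^ m)"
  have "((\<lambda>h. \<Sum>m\<le>2 * n. F m * (M h m / h ^ (2 * n))) \<longlongrightarrow>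
      (\<Sum>m\<le>2 * n. F m * (2 * (\<Sum>i<n. \<Sum>j<n. b i * b j * of_bool (i + j + 2 = m))))) (at_right 0)"
    unfolding M_def by (intro tendsto_intros mom)
  also have "(\<Sum>m\<le>2 * n. F m * (2 * (\<Sum>i<n. \<Sum>j<n. b i * b j * of_bool (i + j + 2 = m)))) = 2 * Q"
    unfolding Q_def sum_convolution[symmetric] by (simp add: sum_distrib_left mult_ac)
  finally have lim: "((\<lambda>h. \<Sum>m\<le>2 * n. F m * (M h m / h ^ (2 * n))) \<longlongrightarrow> 2 * Q) (at_right 0)" .
  have C0: "C \<ge> 0"
  proof (rule order_trans)
    show "0 \<le> (\<Sum>k\<in>K. \<bar>a 1 k\<bar>)" by (simp add: sum_nonneg)
  qed (use C[of 1] in simp)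
  have bound: "2 * Q \<ge> - (e * (C * 2 ^ (2 * n)))" if e: "e > 0" for e
  proof -
    obtain d where d0: "d > 0" and d: "\<And>x. \<bar>x\<bar> < d \<Longrightarrow>
        \<bar>f (t + x) - (\<Sum>k\<le>2 * n. (deriv ^^ k) f t / fact k * x ^ k)\<bar> \<le> e * \<bar>x\<bar> ^ (2 * n)"
      by (rule Ck_on_open_taylor[OF Ck S(1,3) _ e]) (use n in simp, rule that)
    have d: "\<bar>f (t + x) - (\<Sum>k\<le>2 * n. F k * x ^ k)\<bar> \<le> e * \<bar>x\<bar> ^ (2 * n)" if "\<bar>x\<bar> < d" for x
      unfolding F_def by (rule d[OF that])
    obtain r where r: "r > 0" "ball t r \<subseteq> S'" using S openE by blast
    define h0 where "h0 = min 1 (min d r / 3)"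
    have h0: "h0 > 0" using d0 r(1) by (simp add: h0_def)
    have main: "- (e * (C * 2 ^ (2 * n))) \<le> (\<Sum>m\<le>2 * n. F m * (M h m / h ^ (2 * n)))"
        if h: "0 < h" "h < h0" for h
    proof -
      have small: "\<bar>p h k\<bar> < d" "\<bar>p h k\<bar> < r" if "k \<in> K" for k
        using p[OF h(1) that] h by (auto simp: h0_def)
      have "t + p h k \<in> S" if "k \<in> K" for k
      proof -
        have "t + p h k \<in> ball t r" using small(2)[OF that] by (simp add: dist_real_def)
        then show ?thesis using r(2) S(2) by blast
      qed
      then have "0 \<le> (\<Sum>k\<in>K. a h k * f (t + p h k))"
        using tests ct[of h] unfolding passes_convexity_tests_def by blast
      also have "\<dots> = (\<Sum>k\<in>K. a h k * (\<Sum>m\<le>2 * n. F m * p h k ^ m))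
          + (\<Sum>k\<in>K. a h k * (f (t + p h k) - (\<Sum>m\<le>2 * n. F m * p h k ^ m)))"
        by (simp add: sum.distrib[symmetric] algebra_simps)
      also have "(\<Sum>k\<in>K. a h k * (f (t + p h k) - (\<Sum>m\<le>2 * n. F m * p h k ^ m)))
          \<le> (\<Sum>k\<in>K. \<bar>a h k\<bar> * (e * (2 * h) ^ (2 * n)))"
      proof (rule sum_mono)
        fix k assume k: "k \<in> K"
        have "\<bar>f (t + p h k) - (\<Sum>m\<le>2 * n. F m * p h k ^ m)\<bar> \<le> e * \<bar>p h k\<bar> ^ (2 * n)"
          by (rule d[OF small(1)[OF k]])
        also have "\<dots> \<le> e * (2 * h) ^ (2 * n)"
          using e p[OF h(1) k] by (intro mult_left_mono power_mono) auto
        finally have "\<bar>a h k * (f (t + p h k) - (\<Sum>m\<le>2 * n. F m * p h k ^ m))\<bar>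
            \<le> \<bar>a h k\<bar> * (e * (2 * h) ^ (2 * n))"
          unfolding abs_mult by (rule mult_left_mono) simp
        then show "a h k * (f (t + p h k) - (\<Sum>m\<le>2 * n. F m * p h k ^ m))
            \<le> \<bar>a h k\<bar> * (e * (2 * h) ^ (2 * n))"
          by linarith
      qed
      also have "(\<Sum>k\<in>K. \<bar>a h k\<bar> * (e * (2 * h) ^ (2 * n))) \<le> C * (e * (2 * h) ^ (2 * n))"
        unfolding sum_distrib_right[symmetric]
        using C[of h] h e by (intro mult_right_mono) (auto simp: h0_def)
      also have "(\<Sum>k\<in>K. a h k * (\<Sum>m\<le>2 * n. F m * p h k ^ m)) = (\<Sum>m\<le>2 * n. F m * M h m)"
        unfolding M_def sum_distrib_left by (subst sum.swap) (simp add: mult_ac)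
      finally have "0 \<le> (\<Sum>m\<le>2 * n. F m * M h m) + C * (e * (2 * h) ^ (2 * n))" by simp
      then have "0 \<le> ((\<Sum>m\<le>2 * n. F m * M h m) + C * (e * (2 * h) ^ (2 * n))) / h ^ (2 * n)"
        using h(1) by simp
      also have "\<dots> = (\<Sum>m\<le>2 * n. F m * (M h m / h ^ (2 * n))) + e * (C * 2 ^ (2 * n))"
        using h(1) by (simp add: add_divide_distrib sum_divide_distrib power_mult_distrib)
      finally show ?thesis by simp
    qed
    have "\<forall>\<^sub>F h in at_right 0. - (e * (C * 2 ^ (2 * n))) \<le> (\<Sum>m\<le>2 * n. F m * (M h m / h ^ (2 * n)))"
      unfolding eventually_at_right_field using h0 main by blast
    then show ?thesis using lim by (intro tendsto_lowerbound[OF lim]) simp_all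
  qed
  have "Q \<ge> 0"
  proof (rule ccontr)
    assume "\<not> Q \<ge> 0"
    then have Q: "Q < 0" by simp
    define W where "W = C * 2 ^ (2 * n) + 1"
    have W: "W \<ge> 1" using C0 by (simp add: W_def)
    have "- Q / W > 0" using Q W by (simp add: divide_neg_pos)
    then have "2 * Q \<ge> - (- Q / W * (C * 2 ^ (2 * n)))" by (rule bound)
    moreover have "- Q / W * (C * 2 ^ (2 * n)) \<le> - Q / W * W"
      using Q W by (intro mult_left_mono) (auto simp: W_def divide_nonpos_pos)
    ultimately show False using Q W by simp
  qed
  also have "Q = (\<Sum>i<n. \<Sum>j<n. c i * c j * F (i + j + 2))" unfolding Q_def
    by (intro sum.cong refl) (auto simp: b_def)
  finally show ?thesis unfolding F_def .
qed simp

section \<open>From a function to its quotient by the variable\<close>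

text \<open>The value at \<open>x\<close> of the Taylor polynomial of \<open>f\<close> of degree \<open>m\<close> at \<open>t\<close>.\<close>

definition taylor_at :: "(real \<Rightarrow> real) \<Rightarrow> nat \<Rightarrow> real \<Rightarrow> real \<Rightarrow> real" where
  "taylor_at f m t x = (\<Sum>k\<le>m. (deriv ^^ k) f t * (x - t) ^ k / fact k)"

text \<open>As a function of the base point, the Taylor polynomial has a one-term derivative.\<close>

lemma taylor_at_has_derivative:
  assumes d: "\<And>k. k \<le> m \<Longrightarrow> ((deriv ^^ k) f has_real_derivative (deriv ^^ Suc k) f t) (at t)"
  shows "((\<lambda>t. taylor_at f m t x)
      has_real_derivative (deriv ^^ Suc m) f t * (x - t) ^ m / fact m) (at t)"
  using d
proof (induction m)
  case 0
  then show ?case by (simp add: taylor_at_def)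
next
  case (Suc m)
  have "((\<lambda>t. taylor_at f m t x + (deriv ^^ Suc m) f t
      * (x - t) ^ Suc m / fact (Suc m)) has_real_derivative
      (deriv ^^ Suc m) f t * (x - t) ^ m / fact m
      + ((deriv ^^ Suc (Suc m)) f t * (x - t) ^ Suc m
          + (deriv ^^ Suc m) f t * (real (Suc m) * (x - t) ^ m * (- 1))) / fact (Suc m)) (at t)"
    by (rule derivative_eq_intros Suc.IH Suc.prems refl | simp)+
  also have "(\<lambda>t. taylor_at f m t x + (deriv ^^ Suc m) f t * (x - t) ^ Suc m / fact (Suc m))
      = (\<lambda>t. taylor_at f (Suc m) t x)"
    by (simp add: taylor_at_def fun_eq_iff)
  also have "(deriv ^^ Suc m) f t * (x - t) ^ m / fact m
      + ((deriv ^^ Suc (Suc m)) f t * (x - t) ^ Suc m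
          + (deriv ^^ Suc m) f t * (real (Suc m) * (x - t) ^ m * (- 1))) / fact (Suc m)
      = (deriv ^^ Suc (Suc m)) f t * (x - t) ^ Suc m / fact (Suc m)"
    by (simp add: fact_Suc divide_simps)
  finally show ?case .
qed

lemma taylor_at_self: "taylor_at f m t t = f t"
proof -
  have "taylor_at f m t t = (\<Sum>k\<le>m. if k = 0 then f t else 0)"
    unfolding taylor_at_def by (intro sum.cong refl) (auto simp: power_0_left)
  then show ?thesis by simp
qed

text \<open>The \<open>m\<close>-th derivative at \<open>t\<close> of \<open>\<lambda>t. (f t - C) / t\<close>, as the lemmas \<open>quotient_deriv_0\<close> and
  \<open>quotient_deriv_has_derivative\<close> show.\<close>

definition quotient_deriv :: "(real \<Rightarrow> real) \<Rightarrow> real \<Rightarrow> nat \<Rightarrow> real \<Rightarrow> real" where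
  "quotient_deriv f C m t = (-1) ^ m * fact m * (taylor_at f m t 0 - C) / t ^ Suc m"

lemma quotient_deriv_0: "quotient_deriv f C 0 t = (f t - C) / t"
  by (simp add: quotient_deriv_def taylor_at_def)

lemma quotient_deriv_has_derivative:
  assumes t: "t > 0" and d: "\<And>k. k \<le> m \<Longrightarrow> ((deriv ^^ k) f
      has_real_derivative (deriv ^^ Suc k) f t) (at t)"
  shows "(quotient_deriv f C m has_real_derivative quotient_deriv f C (Suc m) t) (at t)"
proof -
  have "((\<lambda>t. (-1) ^ m * fact m * (taylor_at f m t 0 - C) / t ^ Suc m) has_real_derivative
      ((-1) ^ m * fact m * ((deriv ^^ Suc m) f t * (0 - t) ^ m / fact m) * t ^ Suc m
        - (-1) ^ m * fact m * (taylor_at f m t 0 - C) * (real (Suc m) * t ^ m)) / (t ^ Suc m * t ^ Suc m)) (at t)"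
  proof (rule DERIV_divide)
    show "((\<lambda>t. (-1) ^ m * fact m * (taylor_at f m t 0 - C)) has_real_derivative
        (-1) ^ m * fact m * ((deriv ^^ Suc m) f t * (0 - t) ^ m / fact m)) (at t)"
    proof (intro DERIV_cmult)
      show "((\<lambda>t. taylor_at f m t 0 - C) has_real_derivative
          (deriv ^^ Suc m) f t * (0 - t) ^ m / fact m) (at t)"
        using DERIV_diff[OF taylor_at_has_derivative[of m f t 0, OF d] DERIV_const[of C]] by simp
    qed
    show "((\<lambda>t. t ^ Suc m) has_real_derivative real (Suc m) * t ^ m) (at t)"
      using DERIV_pow[of "Suc m" t] by simp
  qed (use t in simp)
  also have "((-1) ^ m * fact m * ((deriv ^^ Suc m) f t * (0 - t) ^ m / fact m) * t ^ Suc m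
        - (-1) ^ m * fact m * (taylor_at f m t 0 - C) * (real (Suc m) * t ^ m)) / (t ^ Suc m * t ^ Suc m)
      = quotient_deriv f C (Suc m) t"
  proof -
    have T: "taylor_at f (Suc m) t 0
        = taylor_at f m t 0 + (deriv ^^ Suc m) f t * (- t) ^ Suc m / fact (Suc m)"
      by (simp add: taylor_at_def)
    have m1: "(- t) ^ k = (-1) ^ k * t ^ k" for k by (rule power_minus)
    have sq: "(-1) ^ m * (-1) ^ m = (1 :: real)" by (simp flip: power_add)
    define s where "s = (-1 :: real) ^ m"
    define T0 where "T0 = taylor_at f m t 0 - C"
    define D where "D = (deriv ^^ Suc m) f t"
    have "(s * fact m * (D * (s * t ^ m) / fact m) * t ^ Suc m - s * fact m * T0
        * (real (Suc m) * t ^ m)) / (t ^ Suc m * t ^ Suc m)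
      = - s * (real (Suc m) * fact m) * (T0 + D * (- s * t ^ Suc m) / (real (Suc m) * fact m)) / t ^ Suc (Suc m)"
    proof -
      have a: "s * fact m * (D * (s * t ^ m) / fact m) = D * t ^ m"
        using sq by (simp add: s_def mult_ac)
      have b: "- s * (real (Suc m) * fact m) * (T0 + D * (- s * t ^ Suc m) / (real (Suc m) * fact m))
        = - s * (real (Suc m) * fact m) * T0 + (s * s) * D * t ^ Suc m"
        by (simp add: divide_simps) (simp add: algebra_simps)
      have c: "s * s = 1" using sq by (simp add: s_def)
      show ?thesis unfolding a b c using t by (simp add: divide_simps) (simp add: algebra_simps)
    qed
    then show ?thesis unfolding quotient_deriv_def T m1 s_def T0_def D_def
      by (simp add: fact_Suc m1 algebra_simps)
  qed
  finally show ?thesis unfolding quotient_deriv_def[abs_def] .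
qed

text \<open>The form is \<open>\<integral> s * (\<Sum>i. c i * s\<^bsup>i\<^esup>)\<^sup>2 ds\<close> over \<open>[0, 1]\<close>.\<close>

lemma cauchy_form_nonneg:
  fixes c :: "nat \<Rightarrow> real"
  shows "0 \<le> (\<Sum>i<n. \<Sum>j<n. c i * c j / real (i + j + 2))"
proof -
  define \<psi> where "\<psi> = (\<lambda>s. \<Sum>i<n. \<Sum>j<n. c i * c j * s ^ (i + j + 2) / real (i + j + 2))"
  have "\<exists>y. DERIV \<psi> s :> y \<and> 0 \<le> y" if s: "0 \<le> s" for s
  proof (intro exI conjI)
    show "DERIV \<psi> s :> s * (\<Sum>i<n. c i * s ^ i)\<^sup>2"
    proof -
      have "DERIV \<psi> s :> (\<Sum>i<n. \<Sum>j<n. c i * c j * s ^ (i + j + 1))"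
        unfolding \<psi>_def
      proof (intro DERIV_sum)
        fix i j
        show "DERIV (\<lambda>s. c i * c j * s ^ (i + j + 2) / real (i + j + 2)) s :> c i * c j * s ^ (i + j + 1)"
        proof -
          have "DERIV (\<lambda>s. c i * c j * s ^ (i + j + 2) / real (i + j + 2)) s :>
              c i * c j * (real (i + j + 2) * s ^ (i + j + 2 - Suc 0)) / real (i + j + 2)"
            by (intro DERIV_cdivide DERIV_cmult DERIV_pow)
          then show ?thesis by (simp add: mult.assoc)
        qed
      qed
      also have "(\<Sum>i<n. \<Sum>j<n. c i * c j * s ^ (i + j + 1)) = s * (\<Sum>i<n. c i * s ^ i)\<^sup>2"
        by (simp add: power2_eq_square sum_product sum_distrib_left power_add mult_ac)
      finally show ?thesis .
    qed
    show "0 \<le> s * (\<Sum>i<n. c i * s ^ i)\<^sup>2" using s by simp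
  qed
  note nondec = this
  have "\<psi> 0 \<le> \<psi> 1"
    by (rule DERIV_nonneg_imp_nondecreasing) (simp, rule nondec)
  then show ?thesis by (simp add: \<psi>_def)
qed

text \<open>The index \<open>i + j + 1\<close> of the derivative and the factorial of \<open>i + j + 2\<close> are those of the
  derivatives of order \<open>i + j + 2\<close> of an antiderivative of the quotient.\<close>

proposition quotient_hankel_form_nonneg:
  assumes cont: "continuous_on {0..<\<gamma>} f" and Ck: "Ck_on_open (2 * n) {0<..<\<gamma>} f"
    and K: "\<And>t c. t \<in> {0<..<\<gamma>} \<Longrightarrow>
      0 \<le> (\<Sum>i<n. \<Sum>j<n. c i * c j * ((deriv ^^ (i + j + 2)) f t / fact (i + j + 2)))"
    and C: "f 0 \<le> C" and t: "t \<in> {0<..<\<gamma>}"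
  shows "0 \<le> (\<Sum>i<n. \<Sum>j<n. c i * c j * (quotient_deriv f C (i + j + 1) t / fact (i + j + 2)))"
proof -
  define b where "b = (\<lambda>i. c i / t ^ Suc i)"
  define w where "w = (\<lambda>i j. b i * b j * (-1) ^ (i + j) / real (i + j + 2))"
  define R where "R = (\<Sum>i<n. \<Sum>j<n. w i j)"
  \<comment> \<open>\<open>\<phi> 0\<close> is the form in question up to the constant \<open>R * C\<close>; replacing the evaluation point \<open>0\<close> by
    \<open>e > 0\<close> avoids derivatives of \<open>f\<close> near \<open>0\<close>\<close>
  define \<phi> where "\<phi> = (\<lambda>e t. - (\<Sum>i<n. \<Sum>j<n. w i j * taylor_at f (i + j + 1) t e))"
  have R: "R \<ge> 0"
    using cauchy_form_nonneg[of "\<lambda>i. b i * (-1) ^ i" n] by (simp add: R_def w_def power_add mult_ac)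
  have der: "((deriv ^^ k) f has_real_derivative (deriv ^^ Suc k) f u) (at u)"
    if "u \<in> {0<..<\<gamma>}" "k < 2 * n" for u k
    by (rule Ck_on_open_has_derivative[OF Ck that(2,1)])
  have \<phi>: "- R * f e \<le> \<phi> e t" if e: "0 < e" "e < t" for e
  proof -
    have "\<exists>y. DERIV (\<phi> e) u :> y \<and> 0 \<le> y" if u: "e \<le> u" "u \<le> t" for u
    proof (intro exI conjI)
      have uI: "u \<in> {0<..<\<gamma>}" using e t u by auto
      let ?y = "(u - e) * (\<Sum>i<n. \<Sum>j<n. (b i * (u - e) ^ i) * (b j * (u - e) ^ j)
          * ((deriv ^^ (i + j + 2)) f u / fact (i + j + 2)))"
      have "DERIV (\<phi> e) u :> - (\<Sum>i<n. \<Sum>j<n. w i j * ((deriv ^^ Suc (i + j + 1)) f u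
          * (e - u) ^ (i + j + 1) / fact (i + j + 1)))"
        unfolding \<phi>_def
        by (intro derivative_intros DERIV_sum DERIV_cmult taylor_at_has_derivative der[OF uI]) auto
      also have "- (\<Sum>i<n. \<Sum>j<n. w i j * ((deriv ^^ Suc (i + j + 1)) f u
          * (e - u) ^ (i + j + 1) / fact (i + j + 1))) = ?y"
        unfolding sum_distrib_left sum_negf[symmetric]
      proof (intro sum.cong refl)
        fix i j
        have "(e - u) ^ (i + j + 1) = - ((-1) ^ (i + j)) * (u - e) ^ (i + j + 1)"
          using power_minus[of "u - e" "i + j + 1"] by simp
        moreover have "(-1) ^ (i + j) * (-1) ^ (i + j) = (1::real)" by (simp flip: power_add)
        moreover have "fact (i + j + 2) = real (i + j + 2) * (fact (i + j + 1) :: real)"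
          by (simp add: fact_Suc)
        ultimately show "- (w i j * ((deriv ^^ Suc (i + j + 1)) f u
            * (e - u) ^ (i + j + 1) / fact (i + j + 1)))
          = (u - e) * ((b i * (u - e) ^ i) * (b j * (u - e) ^ j) * ((deriv ^^ (i + j + 2)) f u / fact (i + j + 2)))"
          by (simp add: w_def power_add mult_ac)
      qed
      finally show "DERIV (\<phi> e) u :> ?y" .
      show "0 \<le> ?y" using K[OF uI] u by (intro mult_nonneg_nonneg) auto
    qed
    note nondec = this
    have "\<phi> e e \<le> \<phi> e t"
      by (rule DERIV_nonneg_imp_nondecreasing) (use e in simp, rule nondec)
    also have "\<phi> e e = - R * f e" by (simp add: \<phi>_def R_def taylor_at_self sum_distrib_right)
    finally show ?thesis .
  qed
  have "\<phi> 0 t \<ge> - R * f 0"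
  proof -
    have "((\<lambda>e. \<phi> e t) \<longlongrightarrow> \<phi> 0 t) (at_right 0)"
      unfolding \<phi>_def taylor_at_def by (intro tendsto_intros) auto
    moreover have "((\<lambda>e. - R * f e) \<longlongrightarrow> - R * f 0) (at_right 0)"
    proof -
      have "continuous_on {0..t} f" using t by (intro continuous_on_subset[OF cont]) auto
      then have "(f \<longlongrightarrow> f 0) (at 0 within {0..t})" using t by (simp add: continuous_on)
      then have "(f \<longlongrightarrow> f 0) (at_right 0)"
        using t by (simp add: at_within_Icc_at_right)
      then show ?thesis by (intro tendsto_intros)
    qed
    moreover have "\<forall>\<^sub>F e in at_right 0. - R * f e \<le> \<phi> e t"
      unfolding eventually_at_right_field using \<phi> t by (intro exI[of _ t]) simp
    ultimately show ?thesis by (intro tendsto_le[of "at_right (0::real)"]) simp_all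
  qed
  moreover have "(\<Sum>i<n. \<Sum>j<n. c i * c j * (quotient_deriv f C (i + j + 1) t / fact (i + j + 2)))
      = \<phi> 0 t + R * C"
  proof -
    have "\<phi> 0 t + R * C = (\<Sum>i<n. \<Sum>j<n. - (w i j * (taylor_at f (i + j + 1) t 0 - C)))"
      by (simp add: \<phi>_def R_def sum_distrib_right sum_subtractf sum_negf right_diff_distrib)
    also have "\<dots> = (\<Sum>i<n. \<Sum>j<n. c i * c j * (quotient_deriv f C (i + j + 1) t / fact (i + j + 2)))"
    proof (intro sum.cong refl)
      fix i j
      define q :: real where "q = fact (i + j + 1)"
      have f2: "fact (i + j + 2) = real (i + j + 2) * q" by (simp add: q_def fact_Suc)
      have "q \<noteq> 0" by (simp add: q_def)
      then show "- (w i j * (taylor_at f (i + j + 1) t 0 - C))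
          = c i * c j * (quotient_deriv f C (i + j + 1) t / fact (i + j + 2))"
        unfolding quotient_deriv_def f2 q_def[symmetric] using t
        by (simp add: w_def b_def power_add mult_ac)
    qed
    finally show ?thesis ..
  qed
  moreover have "R * f 0 \<le> R * C" using R C by (rule mult_left_mono[rotated])
  ultimately show ?thesis by simp
qed

section \<open>Averages over translations\<close>

text \<open>The average of \<open>f\<close> over \<open>[x, x + h]\<close>.  Averaging to the right keeps the left end point of
  the domain \<open>[0, \<gamma>)\<close>.\<close>

definition steklov :: "real \<Rightarrow> (real \<Rightarrow> real) \<Rightarrow> real \<Rightarrow> real" where
  "steklov h f x = integral {0..h} (\<lambda>s. f (x + s)) / h"

lemma DERIV_integral_upper:
  fixes f :: "real \<Rightarrow> real"
  assumes f: "continuous_on UNIV f" and a: "a < x"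
  shows "((\<lambda>y. integral {a..y} f) has_real_derivative f x) (at x)"
proof -
  have "((\<lambda>y. integral {a..y} f) has_real_derivative f x) (at x within {a..x + 1})"
    using a by (intro integral_has_real_derivative continuous_on_subset[OF f]) auto
  moreover have "at x within {a..x + 1} = at x" using a by (intro at_within_interior) simp
  ultimately show ?thesis by simp
qed

lemma steklov_has_derivative:
  assumes f: "continuous_on UNIV f" and h: "h > 0"
  shows "(steklov h f has_real_derivative (f (x + h) - f x) / h) (at x)"
proof -
  define a where "a = x - 1"
  have int: "f integrable_on {u..v}" for u v
    by (intro integrable_continuous_interval continuous_on_subset[OF f]) auto
  have eq: "steklov h f y = (integral {a..y + h} f - integral {a..y} f) / h" if "y \<in> {a<..}" for y
  proof -
    have "integral {0..h} (\<lambda>s. f (y + s)) = integral {y..y + h} f"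
      using integral_shift_Icc_real[of 0 h f y] by (simp add: o_def add.commute)
    also have "\<dots> = integral {a..y + h} f - integral {a..y} f"
      using Henstock_Kurzweil_Integration.integral_combine[of a y "y + h" f] that h int by simp
    finally show ?thesis by (simp add: steklov_def)
  qed
  have "((\<lambda>y. (integral {a..y + h} f - integral {a..y} f) / h)
      has_real_derivative (f (x + h) - f x) / h) (at x)"
  proof (intro DERIV_cdivide DERIV_diff)
    show "((\<lambda>y. integral {a..y + h} f) has_real_derivative f (x + h)) (at x)"
      using DERIV_integral_upper[OF f, of a "x + h"] h
      by (subst DERIV_shift[symmetric]) (simp add: a_def)
    show "((\<lambda>y. integral {a..y} f) has_real_derivative f x) (at x)"
      by (rule DERIV_integral_upper[OF f]) (simp add: a_def)
  qed
  then show ?thesis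
    by (rule has_field_derivative_transform_within_open[of _ _ _ "{a<..}"]) (auto simp: eq a_def)
qed

lemma Ck_on_open_UNIV_continuous: "Ck_on_open k UNIV f \<Longrightarrow> continuous_on UNIV f"
proof (cases k)
  case (Suc m)
  assume "Ck_on_open k UNIV f"
  then have "\<forall>t. f field_differentiable (at t)" unfolding Ck_on_open_def using Suc by fastforce
  then show ?thesis
    by (intro continuous_at_imp_continuous_on) (auto intro: field_differentiable_imp_continuous_at)
qed (simp add: Ck_on_open_def)

text \<open>Each average gains one derivative, given by a difference quotient.\<close>

lemma steklov_Ck:
  assumes f: "Ck_on_open k UNIV f" and h: "h > 0"
  shows "Ck_on_open (Suc k) UNIV (steklov h f)"
proof -
  have cont: "continuous_on UNIV f" by (rule Ck_on_open_UNIV_continuous[OF f])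
  have der: "((deriv ^^ j) f has_real_derivative (deriv ^^ Suc j) f x) (at x)" if "j < k" for j x
    using f that unfolding Ck_on_open_def by (simp add: DERIV_deriv_iff_field_differentiable)
  have iter: "(deriv ^^ Suc j) (steklov h f)
      = (\<lambda>x. ((deriv ^^ j) f (x + h) - (deriv ^^ j) f x) / h)" if "j \<le> k" for j
    using that
  proof (induction j)
    case 0
    show ?case using steklov_has_derivative[OF cont h]
        by (auto simp: fun_eq_iff intro!: DERIV_imp_deriv)
  next
    case (Suc j)
    have "((\<lambda>x. ((deriv ^^ j) f (x + h) - (deriv ^^ j) f x) / h) has_real_derivative
        ((deriv ^^ Suc j) f (x + h) - (deriv ^^ Suc j) f x) / h) (at x)" for x
      using der[of j] Suc.prems by (intro DERIV_cdivide DERIV_diff) (auto simp: DERIV_shift[symmetric])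
    note der' = this
    have IH: "(deriv ^^ Suc j) (steklov h f) = (\<lambda>x. ((deriv ^^ j) f (x + h) - (deriv ^^ j) f x) / h)"
      using Suc by simp
    show ?case
    proof
      fix x
      have "(deriv ^^ Suc (Suc j)) (steklov h f) x = deriv ((deriv ^^ Suc j) (steklov h f)) x" by simp
      also have "\<dots> = ((deriv ^^ Suc j) f (x + h) - (deriv ^^ Suc j) f x) / h"
        unfolding IH by (rule DERIV_imp_deriv[OF der'])
      finally show "(deriv ^^ Suc (Suc j)) (steklov h f) x
          = ((deriv ^^ Suc j) f (x + h) - (deriv ^^ Suc j) f x) / h" .
    qed
  qed
  show ?thesis unfolding Ck_on_open_def
  proof (intro conjI allI impI ballI)
    fix j t assume j: "j < Suc k"
    show "(deriv ^^ j) (steklov h f) field_differentiable at t"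
    proof (cases j)
      case 0
      then show ?thesis using steklov_has_derivative[OF cont h] by (auto simp: field_differentiable_def)
    next
      case (Suc i)
      have "((\<lambda>x. ((deriv ^^ i) f (x + h) - (deriv ^^ i) f x) / h) has_real_derivative
          ((deriv ^^ Suc i) f (t + h) - (deriv ^^ Suc i) f t) / h) (at t)"
        using der[of i] j Suc by (intro DERIV_cdivide DERIV_diff) (auto simp: DERIV_shift[symmetric])
      then show ?thesis using iter[of i] j Suc by (auto simp: field_differentiable_def)
    qed
  next
    have c: "continuous_on UNIV ((deriv ^^ k) f)" using f by (simp add: Ck_on_open_def)
    have "continuous_on UNIV (\<lambda>x. (deriv ^^ k) f (x + h))"
      by (rule continuous_on_compose2[OF c]) (auto intro: continuous_intros)
    then show "continuous_on UNIV ((deriv ^^ Suc k) (steklov h f))"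
      unfolding iter[OF order_refl] using c h
      by (intro continuous_on_divide continuous_on_diff continuous_on_const) auto
  qed
qed

lemma steklov_pow_Ck:
  "continuous_on UNIV f \<Longrightarrow> h > 0 \<Longrightarrow> Ck_on_open m UNIV ((steklov h ^^ m) f)"
proof (induction m)
  case 0
  then show ?case by (simp add: Ck_on_open_def)
next
  case (Suc m)
  then show ?case using steklov_Ck[of m "(steklov h ^^ m) f" h] by simp
qed

lemma steklov_pow_continuous: "continuous_on UNIV f \<Longrightarrow> h > 0 \<Longrightarrow> continuous_on UNIV ((steklov h ^^ m) f)"
  by (rule Ck_on_open_UNIV_continuous[OF steklov_pow_Ck])

lemma steklov_passes_tests:
  assumes f: "continuous_on UNIV f" and h: "h > 0"
    and tests: "passes_convexity_tests n {0..<\<gamma>} f"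
  shows "passes_convexity_tests n {0..<\<gamma> - h} (steklov h f)"
  unfolding passes_convexity_tests_def
proof (intro allI impI)
  fix K a p t
  assume ct: "convexity_test n K a p" and I: "\<forall>k\<in>K. t + p k \<in> {0..<\<gamma> - h}"
  have int: "(\<lambda>s. f (x + s)) integrable_on {0..h}" for x
    by (intro integrable_continuous_interval continuous_on_compose2[OF f] continuous_intros) auto
  have K: "finite K" using ct by (simp add: convexity_test_def)
  have "(\<Sum>k\<in>K. a k * steklov h f (t + p k)) = (\<Sum>k\<in>K. integral {0..h} (\<lambda>s. a k * f (t + p k + s))) / h"
    by (simp add: steklov_def sum_divide_distrib)
  also have "(\<Sum>k\<in>K. integral {0..h} (\<lambda>s. a k * f (t + p k + s)))
      = integral {0..h} (\<lambda>s. \<Sum>k\<in>K. a k * f (t + p k + s))"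
    by (rule integral_sum[symmetric]) (use K int in \<open>auto intro!: integrable_on_mult_right\<close>)
  finally have eq: "(\<Sum>k\<in>K. a k * steklov h f (t + p k))
      = integral {0..h} (\<lambda>s. \<Sum>k\<in>K. a k * f (t + p k + s)) / h" .
  have "0 \<le> (\<Sum>k\<in>K. a k * f (t + p k + s))" if s: "s \<in> {0..h}" for s
  proof -
    have "\<forall>k\<in>K. (t + s) + p k \<in> {0..<\<gamma>}" using I s by fastforce
    then have "0 \<le> (\<Sum>k\<in>K. a k * f ((t + s) + p k))"
      using tests ct unfolding passes_convexity_tests_def by blast
    then show ?thesis by (simp add: add_ac)
  qed
  then have "0 \<le> integral {0..h} (\<lambda>s. \<Sum>k\<in>K. a k * f (t + p k + s))"
    by (intro integral_nonneg integrable_sum) (use K int in \<open>auto intro!: integrable_on_mult_right\<close>)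
  then show "0 \<le> (\<Sum>k\<in>K. a k * steklov h f (t + p k))" unfolding eq using h by simp
qed

lemma steklov_pow_passes_tests:
  assumes f: "continuous_on UNIV f" and h: "h > 0"
    and tests: "passes_convexity_tests n {0..<\<gamma>} f"
  shows "passes_convexity_tests n {0..<\<gamma> - m * h} ((steklov h ^^ m) f)"
proof (induction m)
  case (Suc m)
  have eq: "\<gamma> - real (Suc m) * h = \<gamma> - real m * h - h" by (simp add: algebra_simps)
  show ?case unfolding eq
    using steklov_passes_tests[OF steklov_pow_continuous[OF f h] h Suc.IH] by simp
qed (simp add: tests)

lemma steklov_bounds:
  assumes f: "continuous_on UNIV f" and h: "h > 0" and b: "\<And>y. y \<in> {x..x + h} \<Longrightarrow> l \<le> f y \<and> f y \<le> u"
  shows "l \<le> steklov h f x \<and> steklov h f x \<le> u"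
proof -
  have int: "(\<lambda>s. f (x + s)) integrable_on {0..h}"
    by (intro integrable_continuous_interval continuous_on_compose2[OF f] continuous_intros) auto
  have "integral {0..h} (\<lambda>s. l) \<le> integral {0..h} (\<lambda>s. f (x + s))"
    by (intro integral_le int) (use b in auto)
  moreover have "integral {0..h} (\<lambda>s. f (x + s)) \<le> integral {0..h} (\<lambda>s. u)"
    by (intro integral_le int) (use b in auto)
  ultimately show ?thesis using h by (simp add: steklov_def field_simps)
qed

lemma steklov_pow_bounds:
  assumes f: "continuous_on UNIV f" and h: "h > 0"
    and b: "\<And>y. y \<in> {x..x + m * h} \<Longrightarrow> l \<le> f y \<and> f y \<le> u"
  shows "l \<le> (steklov h ^^ m) f x \<and> (steklov h ^^ m) f x \<le> u"
  using b
proof (induction m arbitrary: x)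
  case (Suc m)
  have "l \<le> (steklov h ^^ m) f y \<and> (steklov h ^^ m) f y \<le> u" if "y \<in> {x..x + h}" for y
    by (rule Suc.IH, rule Suc.prems) (use that in \<open>auto simp: algebra_simps\<close>)
  then show ?case unfolding funpow.simps o_apply
    by (intro steklov_bounds[OF steklov_pow_continuous[OF f h] h])
qed simp

lemma steklov_pow_tendsto:
  assumes f: "continuous_on UNIV f"
  shows "((\<lambda>h. (steklov h ^^ m) f x) \<longlongrightarrow> f x) (at_right 0)"
proof (rule tendstoI)
  fix e :: real assume e: "e > 0"
  have "isCont f x" using f by (simp add: continuous_on_eq_continuous_at)
  then obtain d where d: "d > 0" "\<And>y. dist y x < d \<Longrightarrow> dist (f y) (f x) < e / 2"
    using e unfolding continuous_at_eps_delta by (metis half_gt_zero)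
  have "dist ((steklov h ^^ m) f x) (f x) < e" if h: "0 < h" "h < d / (real m + 1)" for h
  proof -
    have "m * h < d" using h by (simp add: field_simps)
    have "f x - e / 2 \<le> (steklov h ^^ m) f x \<and> (steklov h ^^ m) f x \<le> f x + e / 2"
    proof (rule steklov_pow_bounds[OF f h(1)])
      fix y assume "y \<in> {x..x + m * h}"
      then have "dist y x < d" using \<open>m * h < d\<close> by (auto simp: dist_real_def)
      from d(2)[OF this] show "f x - e / 2 \<le> f y \<and> f y \<le> f x + e / 2"
        unfolding dist_real_def by linarith
    qed
    then show ?thesis using e by (auto simp: dist_real_def)
  qed
  then show "\<forall>\<^sub>F h in at_right 0. dist ((steklov h ^^ m) f x) (f x) < e"
    unfolding eventually_at_right_field using d(1) by (intro exI[of _ "d / (real m + 1)"]) auto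
qed

section \<open>Functions with nonnegative third divided differences\<close>

text \<open>The divided difference of \<open>g\<close> with node set \<open>X\<close>, in its symmetric form.  A set of nodes makes the
  symmetry automatic; the nodes are distinct by definition.\<close>

definition dd :: "(real \<Rightarrow> real) \<Rightarrow> real set \<Rightarrow> real" where
  "dd g X = (\<Sum>x\<in>X. g x / (\<Prod>y\<in>X - {x}. x - y))"

lemma dd_diff:
  assumes Y: "finite Y" and z: "z \<notin> Y" and w: "w \<notin> Y" and zw: "z \<noteq> w"
  shows "dd g (insert w Y) - dd g (insert z Y) = (w - z) * dd g (insert w (insert z Y))"
proof -
  let ?P = "\<lambda>x. \<Prod>y\<in>Y - {x}. x - y"
  have ins: "dd g (insert v Y) = g v / (\<Prod>y\<in>Y. v - y) + (\<Sum>x\<in>Y. g x / ((x - v) * ?P x))" if "v \<notin> Y" for v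
  proof -
    have "(\<Prod>y\<in>insert v Y - {x}. x - y) = (x - v) * ?P x" if "x \<in> Y" for x
    proof -
      have "insert v Y - {x} = insert v (Y - {x})" using that \<open>v \<notin> Y\<close> by auto
      then show ?thesis using Y \<open>v \<notin> Y\<close> by simp
    qed
    moreover have "insert v Y - {v} = Y" using that by auto
    ultimately show ?thesis unfolding dd_def using Y that by simp
  qed
  have ins2: "dd g (insert w (insert z Y))
      = g w / ((w - z) * (\<Prod>y\<in>Y. w - y)) + g z / ((z - w) * (\<Prod>y\<in>Y. z - y))
      + (\<Sum>x\<in>Y. g x / ((x - w) * ((x - z) * ?P x)))"
  proof -
    have "(\<Prod>y\<in>insert w (insert z Y) - {x}. x - y) = (x - w) * ((x - z) * ?P x)" if "x \<in> Y" for x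
    proof -
      have "insert w (insert z Y) - {x} = insert w (insert z (Y - {x}))" using that z w by auto
      then show ?thesis using Y z w zw by simp
    qed
    moreover have "insert w (insert z Y) - {w} = insert z Y" "insert w (insert z Y) - {z} = insert w Y"
      using z w zw by auto
    ultimately show ?thesis unfolding dd_def using Y z w zw by simp
  qed
  have "(w - z) * (g x / ((x - w) * ((x - z) * ?P x)))
      = g x / ((x - w) * ?P x) - g x / ((x - z) * ?P x)" if "x \<in> Y" for x
  proof -
    have "x \<noteq> z" "x \<noteq> w" "?P x \<noteq> 0" using that z w Y by auto
    then show ?thesis by (simp add: divide_simps) (simp add: algebra_simps)
  qed
  then have "(w - z) * (\<Sum>x\<in>Y. g x / ((x - w) * ((x - z) * ?P x)))
      = (\<Sum>x\<in>Y. g x / ((x - w) * ?P x)) - (\<Sum>x\<in>Y. g x / ((x - z) * ?P x))"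
    by (simp add: sum_distrib_left sum_subtractf)
  moreover have "(w - z) * (g w / ((w - z) * (\<Prod>y\<in>Y. w - y))) = g w / (\<Prod>y\<in>Y. w - y)"
    "(w - z) * (g z / ((z - w) * (\<Prod>y\<in>Y. z - y))) = - (g z / (\<Prod>y\<in>Y. z - y))"
  proof -
    have "(\<Prod>y\<in>Y. z - y) \<noteq> 0" using z Y by auto
    then show "(w - z) * (g z / ((z - w) * (\<Prod>y\<in>Y. z - y))) = - (g z / (\<Prod>y\<in>Y. z - y))"
      using zw by (simp add: divide_simps) (simp add: algebra_simps)
  qed (use zw in simp)
  ultimately show ?thesis unfolding ins[OF z] ins[OF w] ins2 by (simp add: distrib_left)
qed

lemma dd_pair: "x \<noteq> y \<Longrightarrow> dd g {x, y} = (g x - g y) / (x - y)"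
proof -
  assume "x \<noteq> y"
  moreover from this have "{x, y} - {x} = {y}" "{x, y} - {y} = {x}" by auto
  ultimately show ?thesis by (simp add: dd_def) (simp add: divide_simps, simp add: algebra_simps)
qed

lemma split_off_Min:
  fixes X :: "real set"
  assumes "card X = Suc k"
  obtains x Y where "X = insert x Y" "card Y = k" "\<And>y. y \<in> Y \<Longrightarrow> x < y"
proof -
  have fin: "finite X" "X \<noteq> {}" using assms card.infinite by fastforce+
  show thesis
  proof (rule that[of "Min X" "X - {Min X}"])
    show "X = insert (Min X) (X - {Min X})" using insert_Diff[OF Min_in[OF fin]] by simp
    show "card (X - {Min X}) = k" using assms fin by (simp add: card_Diff_singleton)
    show "Min X < y" if "y \<in> X - {Min X}" for y
      using that fin Min_le[of X y] by (auto simp: less_le)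
  qed
qed

text \<open>The mean value theorem for divided differences: \<open>dd g X\<close> is a sixth of a value of \<open>g'''\<close>.\<close>

lemma dd_4_nonneg:
  assumes I: "\<And>x y z. x \<in> I \<Longrightarrow> z \<in> I \<Longrightarrow> x \<le> y \<Longrightarrow> y \<le> z \<Longrightarrow> y \<in> I"
    and d1: "\<And>t. t \<in> I \<Longrightarrow> (g has_real_derivative g1 t) (at t)"
    and d2: "\<And>t. t \<in> I \<Longrightarrow> (g1 has_real_derivative g2 t) (at t)"
    and d3: "\<And>t. t \<in> I \<Longrightarrow> (g2 has_real_derivative g3 t) (at t)"
    and pos: "\<And>t. t \<in> I \<Longrightarrow> g3 t \<ge> 0"
    and X: "X \<subseteq> I" "card X = 4"
  shows "dd g X \<ge> 0"
proof -
  have "card X = Suc 3" using X(2) by simp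
  then obtain x0 X0 where x0: "X = insert x0 X0" "card X0 = 3" "\<And>y. y \<in> X0 \<Longrightarrow> x0 < y"
    by (rule split_off_Min) (rule that)
  have "card X0 = Suc 2" using x0(2) by simp
  then obtain x1 X1 where x1: "X0 = insert x1 X1" "card X1 = 2" "\<And>y. y \<in> X1 \<Longrightarrow> x1 < y"
    by (rule split_off_Min) (rule that)
  have "card X1 = Suc 1" using x1(2) by simp
  then obtain x2 X2 where x2: "X1 = insert x2 X2" "card X2 = 1" "\<And>y. y \<in> X2 \<Longrightarrow> x2 < y"
    by (rule split_off_Min) (rule that)
  obtain x3 where x3: "X2 = {x3}" using x2(2) by (metis card_1_singletonE)
  have lt: "x0 < x1" "x1 < x2" "x2 < x3" using x0 x1 x2 x3 by auto
  have Xeq: "X = {x0, x1, x2, x3}" using x0 x1 x2 x3 by auto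
  have mem: "y \<in> I" if "x0 \<le> y" "y \<le> x3" for y using I[of x0 x3 y] X(1) that by (auto simp: Xeq)
  define K where "K = dd g X"
  define a where "a = g x0 / ((x0 - x1) * (x0 - x2))"
  define b where "b = g x1 / ((x1 - x0) * (x1 - x2))"
  define c where "c = g x2 / ((x2 - x0) * (x2 - x1))"
  \<comment> \<open>the error of cubic interpolation; it vanishes at the four nodes, so Rolle's theorem applies three times\<close>
  define e where "e = (\<lambda>t. g t - a * ((t - x1) * (t - x2)) - b * ((t - x0) * (t - x2)) - c
      * ((t - x0) * (t - x1))
    - K * ((t - x0) * ((t - x1) * (t - x2))))"
  define e1 where "e1 = (\<lambda>t. g1 t - a * (2 * t - x1 - x2) - b * (2 * t - x0 - x2) - c
      * (2 * t - x0 - x1)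
    - K * (3 * (t * t) - 2 * (x0 + x1 + x2) * t + (x0 * x1 + x0 * x2 + x1 * x2)))"
  define e2 where "e2 = (\<lambda>t. g2 t - a * 2 - b * 2 - c * 2 - K * (6 * t - 2 * (x0 + x1 + x2)))"
  have D1: "(e has_real_derivative e1 t) (at t)" if "t \<in> I" for t
    unfolding e_def e1_def
    by (rule derivative_eq_intros d1[OF that] refl)+ (simp add: algebra_simps)
  have D2: "(e1 has_real_derivative e2 t) (at t)" if "t \<in> I" for t
  proof (rule DERIV_cong)
    let ?q' = "3 * (t * 1 + 1 * t) - 2 * (x0 + x1 + x2) * 1 + 0"
    show "(e1 has_real_derivative g2 t - a * (2 * 1 - 0 - 0) - b * (2 * 1 - 0 - 0) - c
        * (2 * 1 - 0 - 0) - K * ?q') (at t)"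
      unfolding e1_def
      by (intro DERIV_diff DERIV_add DERIV_cmult DERIV_mult' DERIV_ident DERIV_const d2[OF that])
    show "g2 t - a * (2 * 1 - 0 - 0) - b * (2 * 1 - 0 - 0) - c * (2 * 1 - 0 - 0) - K * ?q' = e2 t"
      by (simp add: e2_def)
  qed
  have D3: "(e2 has_real_derivative g3 t - 6 * K) (at t)" if "t \<in> I" for t
    unfolding e2_def using d3[OF that] by (auto intro!: derivative_eq_intros)
  have e0: "e x0 = 0" "e x1 = 0" "e x2 = 0"
    using lt by (simp_all add: e_def a_def b_def c_def)
  have e3: "e x3 = 0"
  proof -
    have s: "{x0, x1, x2, x3} - {x0} = {x1, x2, x3}" "{x0, x1, x2, x3} - {x1} = {x0, x2, x3}"
      "{x0, x1, x2, x3} - {x2} = {x0, x1, x3}" "{x0, x1, x2, x3} - {x3} = {x0, x1, x2}" using lt by auto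
    have n: "x0 \<noteq> x1" "x0 \<noteq> x2" "x0 \<noteq> x3" "x1 \<noteq> x2" "x1 \<noteq> x3" "x2 \<noteq> x3" using lt by auto
    define P where "P = (x3 - x0) * ((x3 - x1) * (x3 - x2))"
    have K: "K = g x0 / ((x0 - x1) * ((x0 - x2) * (x0 - x3))) + g x1 / ((x1 - x0) * ((x1 - x2)
        * (x1 - x3)))
      + g x2 / ((x2 - x0) * ((x2 - x1) * (x2 - x3))) + g x3 / P"
      unfolding K_def dd_def Xeq P_def using n by (simp add: s add.assoc)
    have t0: "g x0 / ((x0 - x1) * ((x0 - x2) * (x0 - x3))) * P = - (a * ((x3 - x1) * (x3 - x2)))"
      using n by (simp add: a_def P_def divide_simps) (simp add: algebra_simps)
    have t1: "g x1 / ((x1 - x0) * ((x1 - x2) * (x1 - x3))) * P = - (b * ((x3 - x0) * (x3 - x2)))"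
      using n by (simp add: b_def P_def divide_simps) (simp add: algebra_simps)
    have t2: "g x2 / ((x2 - x0) * ((x2 - x1) * (x2 - x3))) * P = - (c * ((x3 - x0) * (x3 - x1)))"
      using n by (simp add: c_def P_def divide_simps) (simp add: algebra_simps)
    have t3: "g x3 / P * P = g x3" using n by (simp add: P_def)
    have "K * P = - (a * ((x3 - x1) * (x3 - x2))) - b * ((x3 - x0) * (x3 - x2)) - c * ((x3 - x0)
        * (x3 - x1)) + g x3"
      unfolding K distrib_right t0 t1 t2 t3 by simp
    then show ?thesis by (simp add: e_def P_def)
  qed
  have rolle: "\<exists>z. u < z \<and> z < v \<and> f' z = 0"
    if "u < v" "x0 \<le> u" "v \<le> x3" "f u = 0" "f v = 0" "\<And>t. t \<in> I \<Longrightarrow> (f has_real_derivative f' t) (at t)"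
    for u v and f f' :: "real \<Rightarrow> real"
  proof -
    have "\<exists>z>u. z < v \<and> f v - f u = (v - u) * f' z"
      using that mem by (intro MVT2) auto
    then show ?thesis using that by auto
  qed
  obtain y0 where y0: "x0 < y0" "y0 < x1" "e1 y0 = 0" using rolle[of x0 x1 e e1] e0 lt D1 by auto
  obtain y1 where y1: "x1 < y1" "y1 < x2" "e1 y1 = 0" using rolle[of x1 x2 e e1] e0 lt D1 by auto
  obtain y2 where y2: "x2 < y2" "y2 < x3" "e1 y2 = 0" using rolle[of x2 x3 e e1] e0 e3 lt D1 by auto
  obtain z0 where z0: "y0 < z0" "z0 < y1" "e2 z0 = 0" using rolle[of y0 y1 e1 e2] y0 y1 y2 D2 by auto
  obtain z1 where z1: "y1 < z1" "z1 < y2" "e2 z1 = 0" using rolle[of y1 y2 e1 e2] y0 y1 y2 D2 by auto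
  obtain \<xi> where \<xi>: "z0 < \<xi>" "\<xi> < z1" "g3 \<xi> - 6 * K = 0"
    using rolle[of z0 z1 e2 "\<lambda>t. g3 t - 6 * K"] y0 y1 y2 z0 z1 D3 by auto
  have "\<xi> \<in> I" using mem \<xi> y0 y2 z0 z1 by auto
  then show ?thesis using pos[of \<xi>] \<xi>(3) by (simp add: K_def)
qed

lemma dd_tendsto:
  assumes "\<And>x. x \<in> X \<Longrightarrow> ((\<lambda>h. G h x) \<longlongrightarrow> g x) F"
  shows "((\<lambda>h. dd (G h) X) \<longlongrightarrow> dd g X) F"
proof -
  have "((\<lambda>h. \<Sum>x\<in>X. G h x * inverse (\<Prod>y\<in>X - {x}. x - y)) \<longlongrightarrow> (\<Sum>x\<in>X. g x * inverse (\<Prod>y\<in>X - {x}. x - y))) F"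
    by (intro tendsto_sum tendsto_mult tendsto_const assms)
  then show ?thesis by (simp add: dd_def divide_inverse)
qed

context
  fixes g :: "real \<Rightarrow> real" and \<gamma> :: real
  assumes dd4: "\<And>X. X \<subseteq> {0<..<\<gamma>} \<Longrightarrow> card X = 4 \<Longrightarrow> dd g X \<ge> 0"
begin

text \<open>Moving one of three nodes to the right increases the divided difference.\<close>

lemma dd_3_mono:
  assumes "card Y = 2" "Y \<subseteq> {0<..<\<gamma>}" "z < w" "z \<in> {0<..<\<gamma>} - Y" "w \<in> {0<..<\<gamma>} - Y"
  shows "dd g (insert z Y) \<le> dd g (insert w Y)"
proof -
  have Y: "finite Y" using assms(1) card.infinite by fastforce
  have "dd g (insert w (insert z Y)) \<ge> 0"
    using assms Y by (intro dd4) auto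
  then have "0 \<le> (w - z) * dd g (insert w (insert z Y))" using assms(3) by simp
  then show ?thesis using dd_diff[of Y z w g] Y assms by simp
qed

text \<open>Moving the nodes one by one to fixed triples on either side of \<open>[a, b]\<close> bounds the divided
  difference from both sides.\<close>

lemma dd_3_bounded:
  assumes ab: "0 < a" "a < b" "b < \<gamma>"
  obtains C where "C \<ge> 0" "\<And>x y z. x \<in> {a..b} \<Longrightarrow> y \<in> {a..b} \<Longrightarrow> z \<in> {a..b} \<Longrightarrow>
    x \<noteq> y \<Longrightarrow> x \<noteq> z \<Longrightarrow> y \<noteq> z \<Longrightarrow> \<bar>dd g {x, y, z}\<bar> \<le> C"
proof -
  define a1 a2 a3 where "a1 = a / 4" and "a2 = a / 3" and "a3 = a / 2"
  define d where "d = (\<gamma> - b) / 4"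
  define b1 b2 b3 where "b1 = b + d" and "b2 = b + 2 * d" and "b3 = b + 3 * d"
  have A: "0 < a1" "a1 < a2" "a2 < a3" "a3 < a" using ab by (auto simp: a1_def a2_def a3_def)
  have d: "0 < d" "b + 4 * d = \<gamma>" using ab by (auto simp: d_def field_simps)
  have B: "b < b1" "b1 < b2" "b2 < b3" "b3 < \<gamma>" using d by (auto simp: b1_def b2_def b3_def)
  have step: "dd g {p, q, z} \<le> dd g {p, q, w}"
    if "0 < p" "p < \<gamma>" "0 < q" "q < \<gamma>" "p \<noteq> q" "0 < z" "z < w" "w < \<gamma>" "p \<noteq> z" "q \<noteq> z" "p \<noteq> w" "q \<noteq> w" for p q z w
    using dd_3_mono[of "{p, q}" z w] that by (simp add: insert_commute)
  show thesis
  proof (rule that[of "\<bar>dd g {a1, a2, a3}\<bar> + \<bar>dd g {b1, b2, b3}\<bar>"])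
    fix x y z assume xyz: "x \<in> {a..b}" "y \<in> {a..b}" "z \<in> {a..b}" "x \<noteq> y" "x \<noteq> z" "y \<noteq> z"
    have ord: "a \<le> x" "x \<le> b" "a \<le> y" "y \<le> b" "a \<le> z" "z \<le> b" using xyz by simp_all
    note ord = A B ord
    note ne = xyz(4-6) xyz(4-6)[symmetric]
    have "dd g {a1, a2, a3} \<le> dd g {a1, a2, z}" by (rule step; (rule ne | use ord in linarith))
    also have "\<dots> = dd g {a1, z, a2}" by (simp add: insert_commute)
    also have "\<dots> \<le> dd g {a1, z, y}" by (rule step; (rule ne | use ord in linarith))
    also have "\<dots> = dd g {y, z, a1}" by (simp add: insert_commute)
    also have "\<dots> \<le> dd g {y, z, x}" by (rule step; (rule ne | use ord in linarith))
    finally have low: "dd g {a1, a2, a3} \<le> dd g {y, z, x}" .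
    have "dd g {y, z, x} \<le> dd g {y, z, b1}" by (rule step; (rule ne | use ord in linarith))
    also have "\<dots> = dd g {b1, z, y}" by (simp add: insert_commute)
    also have "\<dots> \<le> dd g {b1, z, b2}" by (rule step; (rule ne | use ord in linarith))
    also have "\<dots> = dd g {b1, b2, z}" by (simp add: insert_commute)
    also have "\<dots> \<le> dd g {b1, b2, b3}" by (rule step; (rule ne | use ord in linarith))
    finally have up: "dd g {y, z, x} \<le> dd g {b1, b2, b3}" .
    have eq: "dd g {x, y, z} = dd g {y, z, x}" by (simp add: insert_commute)
    show "\<bar>dd g {x, y, z}\<bar> \<le> \<bar>dd g {a1, a2, a3}\<bar> + \<bar>dd g {b1, b2, b3}\<bar>"
      unfolding eq using low up by linarith
  qed simp
qed

lemma dd_2_lipschitz: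
  assumes ab: "0 < a" "a < b" "b < \<gamma>"
  obtains C where "C \<ge> 0" "\<And>x y z. x \<in> {a..b} \<Longrightarrow> y \<in> {a..b} - {x} \<Longrightarrow> z \<in> {a..b} - {x} \<Longrightarrow>
    \<bar>dd g {x, y} - dd g {x, z}\<bar> \<le> C * \<bar>y - z\<bar>"
proof -
  obtain C where C: "C \<ge> 0" "\<And>x y z. x \<in> {a..b} \<Longrightarrow> y \<in> {a..b} \<Longrightarrow> z \<in> {a..b} \<Longrightarrow>
    x \<noteq> y \<Longrightarrow> x \<noteq> z \<Longrightarrow> y \<noteq> z \<Longrightarrow> \<bar>dd g {x, y, z}\<bar> \<le> C"
    by (rule dd_3_bounded[OF ab]) (rule that)
  show thesis
  proof (rule that[OF C(1)])
    fix x y z assume xyz: "x \<in> {a..b}" "y \<in> {a..b} - {x}" "z \<in> {a..b} - {x}"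
    show "\<bar>dd g {x, y} - dd g {x, z}\<bar> \<le> C * \<bar>y - z\<bar>"
    proof (cases "y = z")
      case False
      have "dd g {y, x} - dd g {z, x} = (y - z) * dd g {y, z, x}"
        using dd_diff[of "{x}" z y g] False xyz by simp
      moreover have "\<bar>dd g {y, z, x}\<bar> \<le> C" using C(2)[of y z x] False xyz by auto
      ultimately have "\<bar>dd g {y, x} - dd g {z, x}\<bar> \<le> \<bar>y - z\<bar> * C"
        by (simp add: abs_mult mult_left_mono)
      then show ?thesis by (simp add: insert_commute mult.commute)
    qed simp
  qed
qed

text \<open>A Lipschitz difference quotient extends continuously to the diagonal.\<close>

lemma dd_nonneg_imp_differentiable:
  assumes x: "x \<in> {0<..<\<gamma>}"
  shows "(g has_real_derivative deriv g x) (at x)"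
proof -
  obtain a where a: "0 < a" "a < x" using x dense[of 0 x] by auto
  obtain b where b: "x < b" "b < \<gamma>" using x dense[of x \<gamma>] by auto
  obtain C where C: "C \<ge> 0" "\<And>x y z. x \<in> {a..b} \<Longrightarrow> y \<in> {a..b} - {x} \<Longrightarrow> z \<in> {a..b} - {x} \<Longrightarrow>
    \<bar>dd g {x, y} - dd g {x, z}\<bar> \<le> C * \<bar>y - z\<bar>"
    by (rule dd_2_lipschitz[of a b]) (use a b in simp, use a b in simp, use a b in simp, rule that)
  let ?X = "{a..b} - {x}"
  have "C-lipschitz_on ?X (\<lambda>y. dd g {x, y})"
    using C a b by (intro lipschitz_onI) (auto simp: dist_real_def)
  then have "uniformly_continuous_on ?X (\<lambda>y. dd g {x, y})"
    by (rule lipschitz_on_uniformly_continuous)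
  moreover have at: "at x within ?X = at x"
  proof -
    have "at x within ?X = at x within {a..b}" by (simp add: at_within_def)
    also have "\<dots> = at x" using a b by (intro at_within_interior) simp
    finally show ?thesis .
  qed
  moreover have "x \<in> closure ?X"
  proof -
    have "x islimpt ?X" using at by (metis trivial_limit_within trivial_limit_at)
    then show ?thesis by (simp add: islimpt_in_closure)
  qed
  ultimately obtain l where "((\<lambda>y. dd g {x, y}) \<longlongrightarrow> l) (at x)"
    using uniformly_continuous_on_extension_at_closure[of ?X "\<lambda>y. dd g {x, y}" x] by auto
  then have "((\<lambda>y. (g y - g x) / (y - x)) \<longlongrightarrow> l) (at x)"
    by (rule Lim_transform_eventually)
      (auto simp: eventually_at_filter dd_pair insert_commute[of x] intro!: always_eventually)
  then have "(g has_real_derivative l) (at x)" by (simp add: has_field_derivative_iff)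
  then show ?thesis by (metis DERIV_imp_deriv)
qed

lemma dd_pair_tendsto_deriv:
  assumes x: "x \<in> {0<..<\<gamma>}"
  shows "((\<lambda>y. dd g {x, y}) \<longlongrightarrow> deriv g x) (at x)"
proof -
  have "((\<lambda>y. (g y - g x) / (y - x)) \<longlongrightarrow> deriv g x) (at x)"
    using dd_nonneg_imp_differentiable[OF x] by (simp add: has_field_derivative_iff)
  then show ?thesis
    by (rule Lim_transform_eventually)
      (auto simp: eventually_at_filter dd_pair insert_commute[of x] intro!: always_eventually)
qed

lemma dd_nonneg_imp_continuous_deriv: "continuous_on {0<..<\<gamma>} (deriv g)"
proof (rule continuous_at_imp_continuous_on, rule ballI)
  fix x assume x: "x \<in> {0<..<\<gamma>}"
  obtain a where a: "0 < a" "a < x" using x dense[of 0 x] by auto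
  obtain b where b: "x < b" "b < \<gamma>" using x dense[of x \<gamma>] by auto
  obtain C where C: "C \<ge> 0" "\<And>x y z. x \<in> {a..b} \<Longrightarrow> y \<in> {a..b} - {x} \<Longrightarrow> z \<in> {a..b} - {x} \<Longrightarrow>
    \<bar>dd g {x, y} - dd g {x, z}\<bar> \<le> C * \<bar>y - z\<bar>"
    by (rule dd_2_lipschitz[of a b]) (use a b in simp, use a b in simp, use a b in simp, rule that)
  have close: "\<bar>dd g {u, v} - deriv g u\<bar> \<le> C * \<bar>v - u\<bar>" if u: "u \<in> {a<..<b}"
      and v: "v \<in> {a<..<b}" "u \<noteq> v" for u v
  proof -
    have "((\<lambda>z. \<bar>dd g {u, v} - dd g {u, z}\<bar>) \<longlongrightarrow> \<bar>dd g {u, v} - deriv g u\<bar>) (at u)"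
      using u a b by (intro tendsto_intros dd_pair_tendsto_deriv) auto
    moreover have "((\<lambda>z. C * \<bar>v - z\<bar>) \<longlongrightarrow> C * \<bar>v - u\<bar>) (at u)" by (intro tendsto_intros)
    moreover have "\<forall>\<^sub>F z in at u. \<bar>dd g {u, v} - dd g {u, z}\<bar> \<le> C * \<bar>v - z\<bar>"
    proof -
      have "\<forall>\<^sub>F z in at u. z \<in> {a<..<b} - {u}"
        using u by (intro eventually_at_in_open) auto
      then show ?thesis by (rule eventually_mono) (use C(2)[of u v] u v in auto)
    qed
    ultimately show ?thesis by (intro tendsto_le[of "at u"]) simp_all
  qed
  have "\<bar>deriv g y - deriv g x\<bar> \<le> 2 * C * \<bar>y - x\<bar>" if y: "y \<in> {a<..<b}" for y
  proof (cases "y = x")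
    case False
    have xab: "x \<in> {a<..<b}" using a b by simp
    have "\<bar>dd g {x, y} - deriv g x\<bar> \<le> C * \<bar>y - x\<bar>" using close[of x y] xab y False by auto
    moreover have "\<bar>dd g {x, y} - deriv g y\<bar> \<le> C * \<bar>y - x\<bar>"
      using close[of y x] xab y False by (auto simp: insert_commute abs_minus_commute)
    ultimately show ?thesis by linarith
  qed simp
  then have "\<forall>\<^sub>F y in at x. norm (deriv g y - deriv g x) \<le> 2 * C * \<bar>y - x\<bar>"
    using a b eventually_at_in_open[of "{a<..<b}" x] by (auto elim!: eventually_mono)
  moreover have "((\<lambda>y. 2 * C * \<bar>y - x\<bar>) \<longlongrightarrow> 0) (at x)"
    by (intro tendsto_mult_right_zero tendsto_rabs_zero LIM_zero tendsto_ident_at)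
  ultimately have "((\<lambda>y. deriv g y - deriv g x) \<longlongrightarrow> 0) (at x)"
    by (rule Lim_null_comparison)
  then show "isCont (deriv g) x" unfolding isCont_def by (simp add: LIM_zero_iff)
qed

text \<open>The limit for \<open>h \<rightarrow> 0\<close> of \<open>dd g {a, a + h, b} \<le> dd g {a + h, b, b + h}\<close>, multiplied by \<open>b - a\<close>.\<close>

lemma dd_nonneg_imp_trapezoid:
  assumes a: "0 < a" and ab: "a < b" and b: "b < \<gamma>"
  shows "2 * ((g b - g a) / (b - a)) \<le> deriv g a + deriv g b"
proof -
  have cont: "isCont g a"
    using dd_nonneg_imp_differentiable[of a] assms by (auto intro: DERIV_isCont)
  define d where "d = min (b - a) (\<gamma> - b)"
  have d: "d > 0" using assms by (simp add: d_def)
  have ineq: "dd g {b, a + h} - dd g {a, a + h} \<le> dd g {b, b + h} - dd g {b, a + h}"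
      if h: "0 < h" "h < d" for h
  proof -
    have h': "a + h < b" "b + h < \<gamma>" using h by (auto simp: d_def)
    have "dd g (insert a {a + h, b}) \<le> dd g (insert (b + h) {a + h, b})"
      using h h' assms by (intro dd_3_mono) auto
    then have mono: "dd g {b, a, a + h} \<le> dd g {b + h, a + h, b}" by (simp add: insert_commute)
    have 1: "dd g {b, a + h} - dd g {a, a + h} = (b - a) * dd g {b, a, a + h}"
      using dd_diff[of "{a + h}" a b g] h h' ab by simp
    have 2: "dd g {b + h, b} - dd g {a + h, b} = (b - a) * dd g {b + h, a + h, b}"
      using dd_diff[of "{b}" "a + h" "b + h" g] h h' ab by simp
    have "(b - a) * dd g {b, a, a + h} \<le> (b - a) * dd g {b + h, a + h, b}"
      using mono ab by (intro mult_left_mono) auto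
    then show ?thesis using 1 2 by (simp add: insert_commute)
  qed
  have sh: "filterlim (\<lambda>h. x + h) (at x) (at_right 0)" for x :: real
    unfolding filterlim_at by (auto intro!: tendsto_eq_intros simp: eventually_at_filter)
  have la: "((\<lambda>h. dd g {a, a + h}) \<longlongrightarrow> deriv g a) (at_right 0)"
    using filterlim_compose[OF dd_pair_tendsto_deriv[of a] sh] assms by simp
  have lb: "((\<lambda>h. dd g {b, b + h}) \<longlongrightarrow> deriv g b) (at_right 0)"
    using filterlim_compose[OF dd_pair_tendsto_deriv[of b] sh] assms by simp
  have lm: "((\<lambda>h. dd g {b, a + h}) \<longlongrightarrow> (g b - g a) / (b - a)) (at_right 0)"
  proof -
    have "((\<lambda>h. g (a + h)) \<longlongrightarrow> g a) (at_right 0)"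
      using filterlim_compose[OF cont[unfolded isCont_def] sh] .
    then have "((\<lambda>h. (g b - g (a + h)) / (b - (a + h))) \<longlongrightarrow> (g b - g a) / (b - (a + 0))) (at_right 0)"
      using ab by (intro tendsto_intros) auto
    then have "((\<lambda>h. (g b - g (a + h)) / (b - (a + h))) \<longlongrightarrow> (g b - g a) / (b - a)) (at_right 0)" by simp
    then show ?thesis
    proof (rule Lim_transform_eventually)
      show "\<forall>\<^sub>F h in at_right 0. (g b - g (a + h)) / (b - (a + h)) = dd g {b, a + h}"
        unfolding eventually_at_right_field using ab
        by (intro exI[of _ "b - a"]) (auto simp: dd_pair)
    qed
  qed
  have low: "((\<lambda>h. dd g {b, a + h} - dd g {a, a + h}) \<longlongrightarrow> (g b - g a) / (b - a) - deriv g a) (at_right 0)"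
    by (intro tendsto_intros la lm)
  have up: "((\<lambda>h. dd g {b, b + h} - dd g {b, a + h}) \<longlongrightarrow> deriv g b - (g b - g a) / (b - a)) (at_right 0)"
    by (intro tendsto_intros lb lm)
  have "\<forall>\<^sub>F h in at_right 0. dd g {b, a + h} - dd g {a, a + h} \<le> dd g {b, b + h} - dd g {b, a + h}"
    unfolding eventually_at_right_field using ineq d by (intro exI[of _ d]) auto
  from tendsto_le[OF trivial_limit_at_right_real up low this]
  have "(g b - g a) / (b - a) - deriv g a \<le> deriv g b - (g b - g a) / (b - a)" .
  then show ?thesis by simp
qed

end

section \<open>Positivity of the antiderivative and the class \<open>Q\<^sub>2\<close>\<close>

lemma pos_semidef_of_real_form:
  assumes sym: "\<And>i j. r i j = r j i"
    and pos: "\<And>c. 0 \<le> (\<Sum>i<n. \<Sum>j<n. c i * c j * r i j)"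
  shows "pos_semidef (mat n n (\<lambda>(i, j). complex_of_real (r i j)))"
  unfolding pos_semidef_def
proof (intro conjI ballI)
  let ?A = "mat n n (\<lambda>(i, j). complex_of_real (r i j))"
  show "selfadjoint ?A" by (rule selfadjoint_real_symmetric) (rule sym)
  fix x :: "complex Matrix.vec" assume "x \<in> carrier_vec (dim_row ?A)"
  then have x: "dim_vec x = n" by simp
  define a b where "a = (\<lambda>i. Re (vec_index x i))" and "b = (\<lambda>i. Im (vec_index x i))"
  have form: "(?A *\<^sub>v x) \<bullet>c x
      = (\<Sum>i<n. \<Sum>j<n. complex_of_real (r i j) * vec_index x j * cnj (vec_index x i))"
    using x by (simp add: scalar_prod_def atLeast0LessThan sum_distrib_right)
  have "Re ((?A *\<^sub>v x) \<bullet>c x) = (\<Sum>i<n. \<Sum>j<n. a i * a j * r i j) + (\<Sum>i<n. \<Sum>j<n. b i * b j * r i j)"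
    unfolding form sum.distrib[symmetric] by (simp add: a_def b_def algebra_simps)
  moreover have "Im ((?A *\<^sub>v x) \<bullet>c x)
      = (\<Sum>i<n. \<Sum>j<n. a i * b j * r i j) - (\<Sum>i<n. \<Sum>j<n. b i * a j * r i j)"
    unfolding form sum_subtractf[symmetric] by (simp add: a_def b_def algebra_simps)
  moreover have "(\<Sum>i<n. \<Sum>j<n. b i * a j * r i j) = (\<Sum>i<n. \<Sum>j<n. a i * b j * r i j)"
    by (subst sum.swap) (simp add: sym mult_ac)
  ultimately show "0 \<le> (?A *\<^sub>v x) \<bullet>c x"
    using pos[of a] pos[of b] by (simp add: less_eq_complex_def)
qed

lemma antiderivative_higher_deriv:
  assumes Ck: "Ck_on_open k {0<..<\<alpha>} f"
    and G: "\<And>t. t \<in> {0<..<\<alpha>} \<Longrightarrow> (G has_real_derivative f t / t) (at t)"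
  shows "m \<le> k \<Longrightarrow> t \<in> {0<..<\<alpha>} \<Longrightarrow> (deriv ^^ Suc m) G t = quotient_deriv f 0 m t"
proof (induction m arbitrary: t)
  case 0
  then show ?case using G[of t] by (simp add: quotient_deriv_0 DERIV_imp_deriv)
next
  case (Suc m)
  have "(quotient_deriv f 0 m has_real_derivative quotient_deriv f 0 (Suc m) t) (at t)"
    using Suc.prems by (intro quotient_deriv_has_derivative Ck_on_open_has_derivative[OF Ck]) auto
  then have "((deriv ^^ Suc m) G has_real_derivative quotient_deriv f 0 (Suc m) t) (at t)"
    by (rule has_field_derivative_transform_within_open[of _ _ _ "{0<..<\<alpha>}"])
      (use Suc in auto)
  then show ?case using DERIV_imp_deriv by simp
qed

text \<open>The coefficient vector \<open>(0, 1)\<close> in \<open>quotient_hankel_form_nonneg\<close> isolates the third derivative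
  of the quotient.\<close>

lemma dd_quotient_nonneg_smooth:
  assumes tests: "passes_convexity_tests 2 {0..<\<gamma>} f" and cont: "continuous_on {0..<\<gamma>} f"
    and Ck: "Ck_on_open 4 {0<..<\<gamma>} f" and C: "f 0 \<le> C"
    and X: "X \<subseteq> {0<..<\<gamma>}" "card X = 4"
  shows "0 \<le> dd (\<lambda>t. (f t - C) / t) X"
proof -
  let ?I = "{0<..<\<gamma>}"
  have Ck': "Ck_on_open (2 * 2) ?I f" using Ck by simp
  have der: "(quotient_deriv f C m has_real_derivative quotient_deriv f C (Suc m) t) (at t)"
    if "t \<in> ?I" "m < 4" for m t
    using that by (intro quotient_deriv_has_derivative Ck_on_open_has_derivative[OF Ck]) auto
  have "0 \<le> dd (quotient_deriv f C 0) X"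
  proof (rule dd_4_nonneg[where I = ?I])
    show "(quotient_deriv f C 0 has_real_derivative quotient_deriv f C 1 t) (at t)" if "t \<in> ?I" for t
      using der[OF that, of 0] by simp
    show "(quotient_deriv f C 1 has_real_derivative quotient_deriv f C 2 t) (at t)" if "t \<in> ?I" for t
      using der[OF that, of 1] by (simp add: numeral_2_eq_2)
    show "(quotient_deriv f C 2 has_real_derivative quotient_deriv f C 3 t) (at t)" if "t \<in> ?I" for t
      using der[OF that, of 2] by (simp add: numeral_3_eq_3)
    show "0 \<le> quotient_deriv f C 3 t" if t: "t \<in> ?I" for t
    proof -
      have "0 \<le> (\<Sum>i<2. \<Sum>j<2. of_bool (i = 1) * of_bool (j
          = 1) * (quotient_deriv f C (i + j + 1) t / fact (i + j + 2)))"
      proof (rule quotient_hankel_form_nonneg[OF cont Ck' _ C t])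
        fix s :: real and c assume s: "s \<in> ?I"
        show "0 \<le> (\<Sum>i<2. \<Sum>j<2. c i * c j * ((deriv ^^ (i + j + 2)) f s / fact (i + j + 2)))"
          by (rule hankel_form_nonneg[OF tests _ _ s Ck']) auto
      qed
      also have "\<dots> = quotient_deriv f C (Suc (Suc (Suc 0))) t / 24"
        by (simp add: numeral_2_eq_2)
      finally show ?thesis by (simp add: numeral_3_eq_3)
    qed
  qed (use X in auto)
  then show ?thesis by (simp add: quotient_deriv_0[abs_def])
qed

lemma dd_quotient_nonneg:
  assumes conv: "n_convex_on 2 {0..<\<alpha>} f" and cont: "continuous_on {0..<\<alpha>} f" and f0: "f 0 \<le> 0"
    and X: "X \<subseteq> {0<..<\<alpha>}" "card X = 4"
  shows "0 \<le> dd (\<lambda>t. f t / t) X"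
proof -
  have fin: "finite X" "X \<noteq> {}" using X(2) card.infinite by fastforce+
  define \<beta> where "\<beta> = (Max X + \<alpha>) / 2"
  have "Max X \<in> X" using fin by simp
  then have \<beta>: "Max X < \<beta>" "\<beta> < \<alpha>" "0 < \<beta>" using X(1) by (auto simp: \<beta>_def)
  \<comment> \<open>a continuous extension of the restriction of \<open>f\<close> to \<open>[0, \<beta>]\<close>, so that averages are defined everywhere\<close>
  define F where "F = (\<lambda>x. f (max 0 (min x \<beta>)))"
  have F: "F x = f x" if "x \<in> {0..\<beta>}" for x using that by (simp add: F_def)
  have contF: "continuous_on UNIV F"
    unfolding F_def using \<beta> by (intro continuous_on_compose2[OF cont] continuous_intros) auto
  have tests: "passes_convexity_tests 2 {0..<\<beta>} F"
    unfolding passes_convexity_tests_def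
  proof (intro allI impI)
    fix K a p t assume ct: "convexity_test 2 K a p" and I: "\<forall>k\<in>K. t + p k \<in> {0..<\<beta>}"
    have "0 \<le> (\<Sum>k\<in>K. a k * f (t + p k))"
    proof -
      have "\<forall>k\<in>K. t + p k \<in> {0..<\<alpha>}" using I \<beta>(2) by fastforce
      then show ?thesis
        using n_convex_on_passes_tests[OF conv] ct unfolding passes_convexity_tests_def by blast
    qed
    also have "\<dots> = (\<Sum>k\<in>K. a k * F (t + p k))"
    proof (intro sum.cong refl)
      fix k assume "k \<in> K"
      then have "t + p k \<in> {0..<\<beta>}" using I by blast
      then show "a k * f (t + p k) = a k * F (t + p k)" by (simp add: F)
    qed
    finally show "0 \<le> (\<Sum>k\<in>K. a k * F (t + p k))" .
  qed
  define S where "S = (\<lambda>h. (steklov h ^^ 4) F)"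
  \<comment> \<open>the averages may be positive at \<open>0\<close>; subtracting \<open>S h 0 - f 0\<close> restores the value \<open>f 0 \<le> 0\<close>\<close>
  define q where "q = (\<lambda>h t. (S h t - (S h 0 - f 0)) / t)"
  have nonneg: "0 \<le> dd (q h) X" if h: "0 < h" "h < (\<beta> - Max X) / 4" for h
    unfolding q_def
  proof (rule dd_quotient_nonneg_smooth[where \<gamma> = "\<beta> - 4 * h"])
    show "passes_convexity_tests 2 {0..<\<beta> - 4 * h} (S h)"
      unfolding S_def using steklov_pow_passes_tests[OF contF h(1) tests, of 4] by simp
    show "continuous_on {0..<\<beta> - 4 * h} (S h)"
      unfolding S_def by (rule continuous_on_subset[OF steklov_pow_continuous[OF contF h(1)]]) simp
    show "Ck_on_open 4 {0<..<\<beta> - 4 * h} (S h)"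
      using steklov_pow_Ck[OF contF h(1), of 4]
      unfolding S_def Ck_on_open_def by (auto intro: continuous_on_subset)
    show "S h 0 \<le> S h 0 - f 0" using f0 by simp
    show "X \<subseteq> {0<..<\<beta> - 4 * h}"
    proof
      fix x assume x: "x \<in> X"
      then have "x \<le> Max X" "0 < x" using Max_ge[OF fin(1)] X(1) by auto
      then show "x \<in> {0<..<\<beta> - 4 * h}" using h(2) by simp
    qed
  qed (rule X(2))
  have lim: "((\<lambda>h. dd (q h) X) \<longlongrightarrow> dd (\<lambda>t. f t / t) X) (at_right 0)"
  proof (rule dd_tendsto)
    fix x assume x: "x \<in> X"
    have "0 < x" using X(1) x by auto
    then have Fx: "F x = f x" using \<beta> Max_ge[OF fin(1) x] by (intro F) simp
    have F0: "F 0 = f 0" using \<beta> by (intro F) simp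
    have "((\<lambda>h. q h x) \<longlongrightarrow> (F x - (F 0 - f 0)) / x) (at_right 0)"
      unfolding q_def S_def using X(1) x
      by (intro tendsto_intros steklov_pow_tendsto[OF contF]) auto
    then show "((\<lambda>h. q h x) \<longlongrightarrow> f x / x) (at_right 0)" by (simp add: Fx F0)
  qed
  have "\<forall>\<^sub>F h in at_right 0. 0 \<le> dd (q h) X"
    unfolding eventually_at_right_field using nonneg \<beta>
    by (intro exI[of _ "(\<beta> - Max X) / 4"]) auto
  then show ?thesis by (rule tendsto_lowerbound[OF lim]) simp
qed

text \<open>A \<open>2 \<times> 2\<close> matrix of divided differences is almost positive precisely when the trapezoid inequality
  holds for the two points or they coincide, since the vectors to be tested are the multiples of \<open>(1, -1)\<close>.\<close>

lemma Q_class_2I: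
  assumes dd: "\<And>X. X \<subseteq> {0<..<\<alpha>} \<Longrightarrow> card X = 4 \<Longrightarrow> 0 \<le> dd g X"
  shows "g \<in> Q_class 2 {0<..<\<alpha>}"
proof -
  let ?I = "{0<..<\<alpha>}"
  have der: "(g has_real_derivative deriv g t) (at t)" if "t \<in> ?I" for t
    by (rule dd_nonneg_imp_differentiable[OF dd that])
  have within: "at t within ?I = at t" if "t \<in> ?I" for t :: real
    using that by (intro at_within_open) auto
  have vd: "vector_derivative g (at t within ?I) = deriv g t" if "t \<in> ?I" for t
    using der[OF that] within[OF that]
    by (simp add: has_real_derivative_iff_has_vector_derivative vector_derivative_at)
  have "C1_on_interval ?I g" unfolding C1_on_interval_def
  proof (intro conjI ballI)
    show "g differentiable (at t within ?I)" if "t \<in> ?I" for t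
      using der[OF that] unfolding within[OF that] real_differentiable_def by blast
    have "continuous_on ?I (deriv g)" by (rule dd_nonneg_imp_continuous_deriv[OF dd])
    then show "continuous_on ?I (\<lambda>t. vector_derivative g (at t within ?I))"
      by (rule continuous_on_eq) (simp only: vd)
  qed
  moreover have "almost_positive (mat 2 2 (\<lambda>(i, j). complex_of_real (divided_diff ?I g (l i) (l j))))"
    if l: "\<forall>i<2. l i \<in> ?I" for l :: "nat \<Rightarrow> real"
  proof -
    define D where "D = (\<lambda>i j. divided_diff ?I g (l i) (l j))"
    have sym: "D i j = D j i" for i j
      by (simp add: D_def divided_diff_def) (metis minus_diff_eq minus_divide_divide)
    have lI: "l 0 \<in> ?I" "l 1 \<in> ?I" using l by auto
    have trap: "2 * ((g b - g a) / (b - a)) \<le> deriv g a + deriv g b" if "a \<in> ?I" "b \<in> ?I" "a < b"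
        for a b
      using dd_nonneg_imp_trapezoid[of \<alpha> g a b] dd that by auto
    have pos: "0 \<le> D 0 0 + D 1 1 - 2 * D 0 1"
    proof (cases "l 0 = l 1")
      case True
      then show ?thesis by (simp add: D_def)
    next
      case False
      have "2 * ((g (l 0) - g (l 1)) / (l 0 - l 1)) \<le> deriv g (l 0) + deriv g (l 1)"
      proof (cases "l 0 < l 1")
        case True
        then show ?thesis using trap[OF lI] by (metis minus_diff_eq minus_divide_divide)
      next
        case False
        then show ?thesis using trap[of "l 1" "l 0"] lI \<open>l 0 \<noteq> l 1\<close> by (simp add: add.commute)
      qed
      then show ?thesis using False lI by (simp add: D_def divided_diff_def vd)
    qed
    let ?A = "mat 2 2 (\<lambda>(i, j). complex_of_real (D i j))"
    have "almost_positive ?A" unfolding almost_positive_def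
    proof (intro conjI allI impI)
      show "selfadjoint ?A" by (rule selfadjoint_real_symmetric) (rule sym)
      fix x :: "nat \<Rightarrow> complex" assume "(\<Sum>i<dim_row ?A. x i) = 0"
      then have x1: "x 1 = - x 0" by (simp add: numeral_2_eq_2 add_eq_0_iff)
      have "(\<Sum>i<dim_row ?A. \<Sum>j<dim_row ?A. ?A $$ (i, j) * x j * cnj (x i))
        = complex_of_real (D 0 0) * x 0 * cnj (x 0) + complex_of_real (D 0 1) * x 1 * cnj (x 0)
          + (complex_of_real (D 1 0) * x 0 * cnj (x 1) + complex_of_real (D 1 1) * x 1 * cnj (x 1))"
        by (simp add: numeral_2_eq_2)
      also have "\<dots> = complex_of_real (D 0 0 + D 1 1 - 2 * D 0 1) * (x 0 * cnj (x 0))"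
        unfolding x1 sym[of 1 0] by (simp add: algebra_simps)
      also have "\<dots> = complex_of_real ((D 0 0 + D 1 1 - 2 * D 0 1) * (cmod (x 0))\<^sup>2)"
        by (simp only: complex_norm_square of_real_mult)
      finally show "0 \<le> (\<Sum>i<dim_row ?A. \<Sum>j<dim_row ?A. ?A $$ (i, j) * x j * cnj (x i))"
        using pos by (simp add: less_eq_complex_def)
    qed
    then show ?thesis by (simp only: D_def)
  qed
  ultimately show ?thesis unfolding Q_class_def by blast
qed

theorem proposition5p1:
  fixes \<alpha> :: real and n :: nat and f g :: "real \<Rightarrow> real"
  assumes "\<alpha> > 0"
    and "continuous_on {0..<\<alpha>} f"
    and "n_convex_on n {0..<\<alpha>} f"
    and "f 0 \<le> 0"
    and "\<And>t. t \<in> {0<..<\<alpha>} \<Longrightarrow> g t = f t / t"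
  shows "(Ck_on_open (2 * n) {0<..<\<alpha>} f \<longrightarrow>
           (\<forall>G. (\<forall>t\<in>{0<..<\<alpha>}. (G has_real_derivative g t) (at t)) \<longrightarrow>
             (\<forall>t\<in>{0<..<\<alpha>}. pos_semidef (K_mat n G t))))
       \<and> (n = 2 \<longrightarrow> g \<in> Q_class 2 {0<..<\<alpha>})"
proof (intro conjI impI allI ballI)
  fix G t assume Ck: "Ck_on_open (2 * n) {0<..<\<alpha>} f"
    and Gg: "\<forall>t\<in>{0<..<\<alpha>}. (G has_real_derivative g t) (at t)" and t: "t \<in> {0<..<\<alpha>}"
  have G: "(G has_real_derivative f u / u) (at u)" if "u \<in> {0<..<\<alpha>}" for u
    using bspec[OF Gg that] by (simp only: assms(5)[OF that])
  define r where "r = (\<lambda>i j. (deriv ^^ (i + j + 2)) G t / fact (i + j + 2))"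
  have "pos_semidef (mat n n (\<lambda>(i, j). complex_of_real (r i j)))"
  proof (rule pos_semidef_of_real_form)
    show "r i j = r j i" for i j by (simp add: r_def add.commute)
    fix c :: "nat \<Rightarrow> real"
    have "0 \<le> (\<Sum>i<n. \<Sum>j<n. c i * c j * (quotient_deriv f 0 (i + j + 1) t / fact (i + j + 2)))"
    proof (rule quotient_hankel_form_nonneg[OF assms(2) Ck _ assms(4) t])
      fix s :: real and c assume s: "s \<in> {0<..<\<alpha>}"
      show "0 \<le> (\<Sum>i<n. \<Sum>j<n. c i * c j * ((deriv ^^ (i + j + 2)) f s / fact (i + j + 2)))"
        by (rule hankel_form_nonneg[OF n_convex_on_passes_tests[OF assms(3)] _ _ s Ck]) auto
    qed
    also have "\<dots> = (\<Sum>i<n. \<Sum>j<n. c i * c j * r i j)"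
    proof (intro sum.cong refl)
      fix i j assume "i \<in> {..<n}" "j \<in> {..<n}"
      then have "(deriv ^^ Suc (i + j + 1)) G t = quotient_deriv f 0 (i + j + 1) t"
        by (intro antiderivative_higher_deriv[OF Ck G _ t]) auto
      then show "c i * c j * (quotient_deriv f 0 (i + j + 1) t / fact (i + j + 2)) = c i * c j * r i j"
        by (simp add: r_def)
    qed
    finally show "0 \<le> (\<Sum>i<n. \<Sum>j<n. c i * c j * r i j)" .
  qed
  then show "pos_semidef (K_mat n G t)" by (simp add: K_mat_def r_def)
next
  assume n: "n = 2"
  show "g \<in> Q_class 2 {0<..<\<alpha>}"
  proof (rule Q_class_2I)
    fix X assume X: "X \<subseteq> {0<..<\<alpha>}" "card X = 4"
    have "0 \<le> dd (\<lambda>t. f t / t) X"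
      using assms(2-4) X by (intro dd_quotient_nonneg) (auto simp: n)
    also have "\<dots> = dd g X" unfolding dd_def using X(1) assms(5) by (intro sum.cong refl) auto
    finally show "0 \<le> dd g X" .
  qed
qed

end
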